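(* Let $q$ be a prime power, $m\ge1$, $1\le k\le n$, $g_1,\dots,g_n\in\mathbb{F}_{q^m}$ linearly independent over $\mathbb{F}_q$, $\mathbf g=(g_1,\dots,g_n)$, $C$ the Gabidulin code defined below, $\mathbf r\in\mathbb{F}_{q^m}^n$, and $t:=\min\{d_R(\mathbf c,\mathbf r):\mathbf c\in C\}$. Let $\{b^{(1)},b^{(2)}\}$ be a minimal basis of the interpolation module $\mathfrak M(\mathbf r)$ with respect to the $(0,k-1)$-weighted term-over-position order with $\mathrm{lpos}(b^{(i)})=i$ ($i=1,2$), write $b^{(i)}=[b^{(i)}_1\ \ b^{(i)}_2]$, and let $\ell_i$ be the $(0,k-1)$-weighted $q$-degree of $b^{(i)}$. If $t\le(n-k)/2$, then $\ell_2=t+k-1$ (equivalently $\mathrm{qdeg}(b^{(2)}_2)=t$) and $\ell_1=n-t$.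
   Context: Write $[i]:=q^i$. A $q$-linearized polynomial is $f(x)=\sum_{i=0}^{d}a_ix^{[i]}$, $a_i\in\mathbb{F}_{q^m}$; if $a_d\ne0$, $d=\mathrm{qdeg}(f)$ ($\mathrm{qdeg}(0)=-\infty$). $\mathcal{L}_q(x,q^m)$ is the ring of these under addition and composition $\circ$. $\Pi_{\mathbf g}(x)=\prod_{u\in\langle g_1,\dots,g_n\rangle}(x-u)$ ($\mathbb{F}_q$-span), of $q$-degree $n$. $\Lambda_{\mathbf g,\mathbf r}(x)=\sum_{i=1}^n(-1)^{n-i}r_i\det(\mathfrak D_i(\mathbf g,x))/\det(M_n(g_1,\dots,g_n))$ ($M_n(v_1,\dots,v_s)$ the $n\times s$ matrix with $(j,l)$ entry $v_l^{[j-1]}$; $\mathfrak D_i(\mathbf g,x)$ is $M_n(g_1,\dots,g_n,x)$ without column $i$), with $\Lambda_{\mathbf g,\mathbf r}(g_i)=r_i$. $C=\{(m(g_1),\dots,m(g_n)):m\in\mathcal{L}_q(x,q^m),\ \mathrm{qdeg}(m)<k\}$. $d_R(\mathbf a,\mathbf b)$ is the $\mathbb{F}_q$-rank of the $m\times n$ $\mathbb{F}_q$-matrix obtained by expanding the coordinates of $\mathbf a-\mathbf b$ in a fixed $\mathbb{F}_q$-basis of $\mathbb{F}_{q^m}$. $\mathfrak M(\mathbf r)$ is the set of all $\beta\circ[\Pi_{\mathbf g}\ \ 0]+\gamma\circ[-\Lambda_{\mathbf g,\mathbf r}\ \ x]$, $\beta,\gamma\in\mathcal{L}_q(x,q^m)$,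 with $h\circ[f_1\ f_2]=[h\circ f_1\ \ h\circ f_2]$. Monomials: $x^{[i]}e_j$, $j\in\{1,2\}$. $(0,k-1)$-weighted term-over-position order: $w_1=0,w_2=k-1$, $x^{[i_1]}e_{j_1}<x^{[i_2]}e_{j_2}$ iff $i_1+w_{j_1}<i_2+w_{j_2}$ or (equality and $j_1<j_2$). $\mathrm{lm},\mathrm{lt},\mathrm{lpos}$: greatest monomial, its term, its coordinate. Weighted $q$-degree of $[f_1\ f_2]$: $\max\{\mathrm{qdeg} f_1,\mathrm{qdeg} f_2+k-1\}$. Basis: generating set with $\sum a_i\circ f^{(i)}=0\Rightarrow a_i=0$. $f$ reduces modulo a set $F$ of nonzero elements in one step if $h=f-\sum_i(b_ix^{[a_i]})\circ f^{(i)}$, $f^{(i)}\in F$, $b_i\in\mathbb{F}_{q^m}$, $a_i\ge0$, with $\mathrm{lm}(f)=x^{[a_i]}\circ\mathrm{lm}(f^{(i)})$ and $\mathrm{lt}(f)=\sum_i(b_ix^{[a_i]})\circ\mathrm{lt}(f^{(i)})$; a basis $B$ is minimal if no $b\in B$ can be reduced modulo $B\setminus\{b\}$. *)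

theory Defs
  imports "HOL-Computational_Algebra.Polynomial" "Jordan_Normal_Form.Determinant"
begin

(* Ambient field F_{q^m} is a finite field type 'a with CARD('a) = q^m.
   The subfield F_q is the fixed field of the q-Frobenius. *)
definition Fq :: "nat \<Rightarrow> 'a::field set" where
  "Fq q = {x. x ^ q = x}"

(* q-linearized polynomials, as genuine polynomials whose only
   monomials are x^(q^i); composition is pcompose. *)
definition linearized :: "nat \<Rightarrow> 'a::field poly \<Rightarrow> bool" where
  "linearized q f \<longleftrightarrow> (\<forall>j. coeff f j \<noteq> 0 \<longrightarrow> (\<exists>i. j = q ^ i))"

definition qdeg :: "nat \<Rightarrow> 'a::field poly \<Rightarrow> nat" where
  "qdeg q f = (THE d. degree f = q ^ d)"

definition xq :: "nat \<Rightarrow> nat \<Rightarrow> 'a::field poly" where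
  "xq q i = monom 1 (q ^ i)"

definition Fq_indep :: "nat \<Rightarrow> nat set \<Rightarrow> (nat \<Rightarrow> 'a::field) \<Rightarrow> bool" where
  "Fq_indep q S v \<longleftrightarrow>
     (\<forall>c. (\<forall>i\<in>S. c i \<in> Fq q) \<and> (\<Sum>i\<in>S. c i * v i) = 0 \<longrightarrow> (\<forall>i\<in>S. c i = 0))"

(* rank distance: F_q-rank of the m x n matrix of F_q-coordinates of a - b,
   i.e. the maximal number of F_q-linearly independent columns *)
definition rank_dist :: "nat \<Rightarrow> nat \<Rightarrow> (nat \<Rightarrow> 'a::field) \<Rightarrow> (nat \<Rightarrow> 'a) \<Rightarrow> nat" where
  "rank_dist q n a b = Max {card S | S. S \<subseteq> {..<n} \<and> Fq_indep q S (\<lambda>i. a i - b i)}"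

definition gabidulin :: "nat \<Rightarrow> nat \<Rightarrow> nat \<Rightarrow> (nat \<Rightarrow> 'a::field) \<Rightarrow> (nat \<Rightarrow> 'a) set" where
  "gabidulin q n k g = {(\<lambda>i. if i < n then poly p (g i) else 0) | p.
        linearized q p \<and> degree p < q ^ k}"

definition Fq_span :: "nat \<Rightarrow> nat \<Rightarrow> (nat \<Rightarrow> 'a::field) \<Rightarrow> 'a set" where
  "Fq_span q n g = {(\<Sum>i<n. c i * g i) | c. \<forall>i<n. c i \<in> Fq q}"

definition Pi_poly :: "nat \<Rightarrow> nat \<Rightarrow> (nat \<Rightarrow> 'a::field) \<Rightarrow> 'a poly" where
  "Pi_poly q n g = (\<Prod>u\<in>Fq_span q n g. [:-u, 1:])"

(* Moore matrix M_n(v_1..v_n), 0-based: entry (j,l) = v_l^(q^j) *)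
definition moore :: "nat \<Rightarrow> nat \<Rightarrow> (nat \<Rightarrow> 'a::field) \<Rightarrow> 'a mat" where
  "moore q n v = mat n n (\<lambda>(j, l). v l ^ (q ^ j))"

(* D_i(g,x): M_n(g_1,..,g_n,x) without column i (0-based i < n), entries in 'a poly *)
definition Dmat :: "nat \<Rightarrow> nat \<Rightarrow> (nat \<Rightarrow> 'a::field) \<Rightarrow> nat \<Rightarrow> 'a poly mat" where
  "Dmat q n g i = mat n n (\<lambda>(j, c).
      if c = n - 1 then monom 1 (q ^ j)
      else if c < i then [: g c ^ (q ^ j) :]
      else [: g (c + 1) ^ (q ^ j) :])"

definition Lambda_poly :: "nat \<Rightarrow> nat \<Rightarrow> (nat \<Rightarrow> 'a::field) \<Rightarrow> (nat \<Rightarrow> 'a) \<Rightarrow> 'a poly" where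
  "Lambda_poly q n g r =
     smult (inverse (det (moore q n g)))
       (\<Sum>i<n. smult ((-1) ^ (n - 1 - i) * r i) (det (Dmat q n g i)))"

(* elements of L_q(x,q^m)^2 as pairs; left composition h o [f1 f2] *)
definition lcomp :: "'a::field poly \<Rightarrow> 'a poly \<times> 'a poly \<Rightarrow> 'a poly \<times> 'a poly" where
  "lcomp h f = (pcompose h (fst f), pcompose h (snd f))"

definition vadd :: "'a::field poly \<times> 'a poly \<Rightarrow> 'a poly \<times> 'a poly \<Rightarrow> 'a poly \<times> 'a poly" where
  "vadd f h = (fst f + fst h, snd f + snd h)"

definition vsum_list :: "('a::field poly \<times> 'a poly) list \<Rightarrow> 'a poly \<times> 'a poly" where
  "vsum_list xs = foldr vadd xs (0, 0)"

definition interp_module :: "nat \<Rightarrow> nat \<Rightarrow> (nat \<Rightarrow> 'a::field) \<Rightarrow> (nat \<Rightarrow> 'a) \<Rightarrow> ('a poly \<times> 'a poly) set" where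
  "interp_module q n g r = {vadd (lcomp \<beta> (Pi_poly q n g, 0)) (lcomp \<gamma> (- Lambda_poly q n g r, [:0, 1:])) | \<beta> \<gamma>.
      linearized q \<beta> \<and> linearized q \<gamma>}"

(* monomials x^[i] e_j encoded as (i, j), j \<in> {1,2}; (0,k-1)-weighted TOP order *)
definition wt :: "nat \<Rightarrow> nat \<Rightarrow> nat" where
  "wt k j = (if j = 1 then 0 else k - 1)"

definition mon_less :: "nat \<Rightarrow> nat \<times> nat \<Rightarrow> nat \<times> nat \<Rightarrow> bool" where
  "mon_less k m1 m2 \<longleftrightarrow>
     fst m1 + wt k (snd m1) < fst m2 + wt k (snd m2) \<or>
     (fst m1 + wt k (snd m1) = fst m2 + wt k (snd m2) \<and> snd m1 < snd m2)"

definition comp_of :: "'a poly \<times> 'a poly \<Rightarrow> nat \<Rightarrow> 'a poly" where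
  "comp_of f j = (if j = 1 then fst f else snd f)"

definition supp :: "nat \<Rightarrow> 'a::field poly \<times> 'a poly \<Rightarrow> (nat \<times> nat) set" where
  "supp q f = {(i, j). j \<in> {1, 2} \<and> coeff (comp_of f j) (q ^ i) \<noteq> 0}"

definition lm_idx :: "nat \<Rightarrow> nat \<Rightarrow> 'a::field poly \<times> 'a poly \<Rightarrow> nat \<times> nat" where
  "lm_idx q k f = (THE m. m \<in> supp q f \<and> (\<forall>m'\<in>supp q f. m' \<noteq> m \<longrightarrow> mon_less k m' m))"

definition lpos :: "nat \<Rightarrow> nat \<Rightarrow> 'a::field poly \<times> 'a poly \<Rightarrow> nat" where
  "lpos q k f = snd (lm_idx q k f)"

definition mon_vec :: "nat \<Rightarrow> 'a::field \<Rightarrow> nat \<times> nat \<Rightarrow> 'a poly \<times> 'a poly" where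
  "mon_vec q c m = (if snd m = 1 then (monom c (q ^ fst m), 0) else (0, monom c (q ^ fst m)))"

definition lm :: "nat \<Rightarrow> nat \<Rightarrow> 'a::field poly \<times> 'a poly \<Rightarrow> 'a poly \<times> 'a poly" where
  "lm q k f = mon_vec q 1 (lm_idx q k f)"

definition lt :: "nat \<Rightarrow> nat \<Rightarrow> 'a::field poly \<times> 'a poly \<Rightarrow> 'a poly \<times> 'a poly" where
  "lt q k f = mon_vec q (coeff (comp_of f (snd (lm_idx q k f))) (q ^ fst (lm_idx q k f))) (lm_idx q k f)"

(* weighted q-degree: max{qdeg f1, qdeg f2 + k - 1}, ignoring zero components (qdeg 0 = -infinity) *)
definition wqdeg :: "nat \<Rightarrow> nat \<Rightarrow> 'a::field poly \<times> 'a poly \<Rightarrow> nat" where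
  "wqdeg q k f = Max ((if fst f \<noteq> 0 then {qdeg q (fst f)} else {}) \<union>
                     (if snd f \<noteq> 0 then {qdeg q (snd f) + (k - 1)} else {}))"

(* f can be reduced modulo F in one step: there are f^(i) \<in> F, b_i, a_i with
   lm f = x^[a_i] o lm f^(i) and lt f = \<Sum> (b_i x^[a_i]) o lt f^(i)
   (the reduced element h is then determined). *)
definition reducible :: "nat \<Rightarrow> nat \<Rightarrow> 'a::field poly \<times> 'a poly \<Rightarrow> ('a poly \<times> 'a poly) set \<Rightarrow> bool" where
  "reducible q k f F \<longleftrightarrow>
     (\<exists>L :: (('a poly \<times> 'a poly) \<times> 'a \<times> nat) list.
        (\<forall>(fi, b, a) \<in> set L. fi \<in> F \<and> lm q k f = lcomp (xq q a) (lm q k fi)) \<and>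
        lt q k f = vsum_list (map (\<lambda>(fi, b, a). lcomp (smult b (xq q a)) (lt q k fi)) L))"

definition is_basis2 :: "nat \<Rightarrow> ('a::field poly \<times> 'a poly) set \<Rightarrow> 'a poly \<times> 'a poly \<Rightarrow> 'a poly \<times> 'a poly \<Rightarrow> bool" where
  "is_basis2 q M b1 b2 \<longleftrightarrow>
     M = {vadd (lcomp a1 b1) (lcomp a2 b2) | a1 a2. linearized q a1 \<and> linearized q a2} \<and>
     (\<forall>a1 a2. linearized q a1 \<and> linearized q a2 \<and> vadd (lcomp a1 b1) (lcomp a2 b2) = (0, 0)
         \<longrightarrow> a1 = 0 \<and> a2 = 0)"

definition minimal_basis2 :: "nat \<Rightarrow> nat \<Rightarrow> ('a::field poly \<times> 'a poly) set \<Rightarrow> 'a poly \<times> 'a poly \<Rightarrow> 'a poly \<times> 'a poly \<Rightarrow> bool" where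
  "minimal_basis2 q k M b1 b2 \<longleftrightarrow>
     is_basis2 q M b1 b2 \<and>
     (\<forall>b\<in>{b1, b2}. \<not> reducible q k b ({b1, b2} - {b}))"

end

theory Submission
  imports Defs "HOL-Number_Theory.Residues" "HOL-Library.FuncSet"
begin

text \<open>Let \<open>f\<close> be a closest codeword, \<open>e\<^sub>i = f(g\<^sub>i) - r\<^sub>i\<close> its error vector of rank \<open>t\<close>, and \<open>W\<close> the error
  locator, the monic linearized polynomial of \<open>q\<close>-degree \<open>t\<close> vanishing on all \<open>e\<^sub>i\<close>. Every \<open>(v\<^sub>1, v\<^sub>2)\<close>
  in the interpolation module satisfies \<open>(v\<^sub>1 + v\<^sub>2 \<circ> f)(g\<^sub>i) = v\<^sub>2(e\<^sub>i)\<close>, and a nonzero linearized \<open>h\<close>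
  with \<open>h(g\<^sub>i) = y(e\<^sub>i)\<close> vanishes on the kernel of \<open>g\<^sub>i \<mapsto> e\<^sub>i\<close>, so \<open>qdeg h \<ge> n - t\<close>.

  Let the basis be \<open>(v\<^sub>1, v\<^sub>2)\<close>, \<open>(u\<^sub>1, u\<^sub>2)\<close>. As the leading positions differ, leading position and
  weighted degree of every combination \<open>a\<^sub>1 \<circ> (v\<^sub>1, v\<^sub>2) + a\<^sub>2 \<circ> (u\<^sub>1, u\<^sub>2)\<close> are predictable. For the module
  element \<open>(-W \<circ> f, W)\<close> this gives \<open>qdeg u\<^sub>2 \<le> t\<close>; then \<open>u\<^sub>1 + u\<^sub>2 \<circ> f\<close> has \<open>q\<close>-degree \<open>< n - t\<close>, so it is
  zero, \<open>u\<^sub>2\<close> kills the errors and \<open>qdeg u\<^sub>2 = t\<close>. On the other side \<open>v\<^sub>1 + v\<^sub>2 \<circ> f \<noteq> 0\<close> gives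
  \<open>qdeg v\<^sub>1 \<ge> n - t\<close>; and in \<open>(\<Pi>\<^sub>g, 0) = a\<^sub>1 \<circ> (v\<^sub>1, v\<^sub>2) + a\<^sub>2 \<circ> (u\<^sub>1, u\<^sub>2)\<close> the factor \<open>a\<^sub>1\<close>, of \<open>q\<close>-degree
  \<open>n - qdeg v\<^sub>1\<close>, vanishes on the \<open>q\<^sup>t\<close> values of \<open>v\<^sub>2\<close> on the error span, so \<open>qdeg v\<^sub>1 \<le> n - t\<close>.\<close>

hide_const (open) UnivPoly.monom UnivPoly.coeff UnivPoly.deg

section \<open>Frobenius powers and the subfield \<open>\<bbbF>\<^sub>q\<close>\<close>

lemma finite_field_power_card:
  fixes x :: "'a :: {field, finite}"
  shows "x ^ card (UNIV :: 'a set) = x"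
proof (cases "x = 0")
  case False
  have "x * (\<Prod>y\<in>UNIV-{0}. x * y) = x * x ^ (card (UNIV :: 'a set) - 1) * \<Prod>(UNIV-{0})"
    by (simp add: prod.distrib mult_ac)
  also have "x * x ^ (card (UNIV :: 'a set) - 1) = x ^ Suc (card (UNIV :: 'a set) - 1)"
    by (subst power_Suc) auto
  also have "Suc (card (UNIV :: 'a set) - 1) = card (UNIV :: 'a set)"
    using finite_UNIV_card_ge_0[where ?'a = 'a] by simp
  also have "(\<Prod>y\<in>UNIV-{0}. x * y) = (\<Prod>y\<in>UNIV-{0}. y)"
    by (rule prod.reindex_bij_witness[of _ "\<lambda>y. y / x" "\<lambda>y. x * y"]) (use False in auto)
  finally show ?thesis
    by simp
qed (use finite_UNIV_card_ge_0[where ?'a = 'a] in auto)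

lemma CHAR_eq_if_card_prime_power:
  fixes p :: nat
  assumes "prime p" "card (UNIV :: 'a :: {field, finite} set) = p ^ N" "N \<ge> 1"
  shows "CHAR('a) = p"
proof -
  have prime_char: "prime CHAR('a)"
    using prime_CHAR_semidom finite_imp_CHAR_pos[OF finite_UNIV] by blast
  have "CHAR('a) dvd p ^ N"
    using CHAR_dvd_CARD[where 'a='a] assms(2) by simp
  hence "CHAR('a) dvd p"
    using prime_dvd_power[OF prime_char] by blast
  thus ?thesis
    using prime_char assms(1) primes_dvd_imp_eq by blast
qed

definition char_power :: "nat \<Rightarrow> 'a::comm_semiring_1 itself \<Rightarrow> bool" where
  "char_power q T \<longleftrightarrow> prime CHAR('a) \<and> (\<exists>e\<ge>1. q = CHAR('a) ^ e)"

lemma char_power_if_card_prime_power: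
  assumes "prime p" "e \<ge> 1" "m \<ge> 1" "card (UNIV :: 'a::{field,finite} set) = (p ^ e) ^ m"
  shows "char_power (p ^ e) TYPE('a)"
proof -
  have "card (UNIV :: 'a set) = p ^ (e * m)"
    using assms(4) by (simp add: power_mult)
  hence "CHAR('a) = p"
    by (rule CHAR_eq_if_card_prime_power[OF assms(1)]) (use assms(2,3) in simp)
  thus ?thesis
    unfolding char_power_def using assms(1,2) by blast
qed

lemma char_power_poly: "char_power q TYPE('a::comm_semiring_1) \<Longrightarrow> char_power q TYPE('a poly)"
  unfolding char_power_def by simp

lemma char_power_ge_2:
  assumes "char_power q TYPE('a::comm_semiring_1)"
  shows "q \<ge> 2"
proof -
  obtain e where "prime CHAR('a)" "e \<ge> 1" "q = CHAR('a) ^ e"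
    using assms unfolding char_power_def by auto
  moreover have "CHAR('a) \<ge> 2"
    using \<open>prime CHAR('a)\<close> prime_ge_2_nat by blast
  ultimately have "CHAR('a) ^ 1 \<le> q"
    by (simp add: self_le_power)
  thus "q \<ge> 2"
    using \<open>CHAR('a) \<ge> 2\<close> by simp
qed

lemma frobenius_sum:
  fixes f :: "'b \<Rightarrow> 'a::comm_semiring_1"
  assumes "char_power q TYPE('a)"
  shows "(sum f A) ^ (q ^ i) = (\<Sum>x\<in>A. f x ^ (q ^ i))"
proof -
  obtain e where "prime CHAR('a)" "q = CHAR('a) ^ e"
    using assms unfolding char_power_def by auto
  moreover have "q ^ i = CHAR('a) ^ (e * i)" if "q = CHAR('a) ^ e"
    using that by (simp add: power_mult)
  ultimately show ?thesis
    using freshmans_dream_sum' by metis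
qed

lemma frobenius_add:
  fixes x y :: "'a::comm_semiring_1"
  assumes "char_power q TYPE('a)"
  shows "(x + y) ^ (q ^ i) = x ^ (q ^ i) + y ^ (q ^ i)"
  using frobenius_sum[OF assms, of "\<lambda>b. if b then x else y" UNIV i] by (simp add: UNIV_bool add.commute)

lemma frobenius_minus:
  fixes x :: "'a::comm_ring_1"
  assumes "char_power q TYPE('a)"
  shows "(- x) ^ (q ^ i) = - (x ^ (q ^ i))"
proof -
  have "0 = (x + - x) ^ (q ^ i)"
    using char_power_ge_2[OF assms] by (simp add: power_0_left)
  also have "\<dots> = x ^ (q ^ i) + (- x) ^ (q ^ i)"
    by (rule frobenius_add[OF assms])
  finally show ?thesis
    by (simp add: eq_neg_iff_add_eq_0 add.commute)
qed

lemma Fq_zero: "q > 0 \<Longrightarrow> 0 \<in> Fq q"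
  and Fq_one: "1 \<in> Fq q"
  unfolding Fq_def by auto

lemma Fq_power_q_power: "c \<in> Fq q \<Longrightarrow> c ^ (q ^ i) = c"
  unfolding Fq_def by (induction i) (simp_all add: power_mult mult.commute)

lemma Fq_add: "char_power q TYPE('a::field) \<Longrightarrow> a \<in> Fq q \<Longrightarrow> b \<in> Fq q \<Longrightarrow> (a::'a) + b \<in> Fq q"
  unfolding Fq_def using frobenius_add[of q a b 1] by simp

lemma Fq_uminus: "char_power q TYPE('a::field) \<Longrightarrow> a \<in> Fq q \<Longrightarrow> - (a::'a) \<in> Fq q"
  unfolding Fq_def using frobenius_minus[of q a 1] by simp

lemma Fq_diff: "char_power q TYPE('a::field) \<Longrightarrow> a \<in> Fq q \<Longrightarrow> b \<in> Fq q \<Longrightarrow> (a::'a) - b \<in> Fq q"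
  using Fq_add[of q a "-b"] Fq_uminus[of q b] by simp

lemma Fq_mult: "a \<in> Fq q \<Longrightarrow> b \<in> Fq q \<Longrightarrow> (a::'a::field) * b \<in> Fq q"
  unfolding Fq_def by (simp add: power_mult_distrib)

lemma Fq_divide: "a \<in> Fq q \<Longrightarrow> b \<in> Fq q \<Longrightarrow> (a::'a::field) / b \<in> Fq q"
  unfolding Fq_def by (simp add: power_divide)

lemma Fq_sum: "char_power q TYPE('a::field) \<Longrightarrow> (\<And>i. i \<in> A \<Longrightarrow> f i \<in> Fq q) \<Longrightarrow> (\<Sum>i\<in>A. f i :: 'a) \<in> Fq q"
  unfolding Fq_def using frobenius_sum[of q f A 1] by simp

lemma degree_monom_minus_x:
  assumes "N \<ge> 2"
  shows "degree (monom (1::'a::field) N - monom 1 1) = N"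
proof (rule antisym)
  show "degree (monom (1::'a) N - monom 1 1) \<le> N"
    using assms by (intro degree_diff_le) (auto intro: order.trans[OF degree_monom_le])
  show "N \<le> degree (monom (1::'a) N - monom 1 1)"
    using assms by (intro le_degree) simp
qed

lemma Fq_eq_roots: "Fq q = {x. poly (monom 1 q - monom 1 1) x = (0::'a::field)}"
  unfolding Fq_def by (auto simp: poly_monom)

lemma card_Fq_le:
  assumes "char_power q TYPE('a::field)"
  shows "finite (Fq q :: 'a set)" "card (Fq q :: 'a set) \<le> q"
proof -
  have q2: "q \<ge> 2"
    using char_power_ge_2[OF assms] .
  have nz: "monom (1::'a) q - monom 1 1 \<noteq> 0"
    using degree_monom_minus_x[OF q2, where 'a='a] q2 by (metis degree_0 not_numeral_le_zero)
  show "finite (Fq q :: 'a set)"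
    unfolding Fq_eq_roots by (rule poly_roots_finite[OF nz])
  show "card (Fq q :: 'a set) \<le> q"
    unfolding Fq_eq_roots by (metis card_poly_roots_bound[OF nz] degree_monom_minus_x[OF q2])
qed

lemma frobenius_poly_dvd:
  assumes "char_power q TYPE('a::field)"
  shows "monom (1::'a) q - monom 1 1 dvd monom 1 (q ^ m) - monom 1 1"
proof -
  define D :: "'a poly" where "D = monom 1 q - monom 1 1"
  have step: "monom 1 (q ^ Suc j) - monom 1 (q ^ j) = D ^ (q ^ j)" for j
  proof -
    have "monom (1::'a) (q ^ Suc j) = (D + monom 1 (q ^ 0)) ^ (q ^ j)"
      unfolding D_def by (simp add: monom_power mult.commute)
    also have "\<dots> = D ^ (q ^ j) + monom 1 (q ^ j)"
      by (simp add: frobenius_add[OF char_power_poly[OF assms]] monom_power)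
    finally show ?thesis
      by simp
  qed
  have "monom 1 (q ^ m) - monom 1 1 = (\<Sum>j<m. monom (1::'a) (q ^ Suc j) - monom 1 (q ^ j))"
    by (subst sum_lessThan_telescope) simp
  also have "\<dots> = (\<Sum>j<m. D ^ (q ^ j))"
    using step by simp
  also have "D dvd \<dots>"
    using char_power_ge_2[OF assms] by (intro dvd_sum dvd_power) auto
  finally show ?thesis
    unfolding D_def .
qed

text \<open>Every field element is a root of \<open>x^(q^m) - x = (x^q - x) E\<close> and \<open>deg E = q^m - q\<close>, so \<open>x^q - x\<close>
  has at least \<open>q\<close> roots.\<close>

lemma card_Fq:
  assumes qc: "char_power q TYPE('a::{field,finite})" and m: "m \<ge> 1"
    and card: "card (UNIV :: 'a set) = q ^ m"
  shows "card (Fq q :: 'a set) = q"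
proof -
  have q2: "q \<ge> 2"
    using char_power_ge_2[OF qc] .
  have "q \<le> q ^ m"
    using q2 m by (intro self_le_power) auto
  hence qm: "q ^ m \<ge> 2"
    using q2 by linarith
  define D :: "'a poly" where "D = monom 1 q - monom 1 1"
  define B :: "'a poly" where "B = monom 1 (q ^ m) - monom 1 1"
  obtain E where BE: "B = D * E"
    using frobenius_poly_dvd[OF qc, of m] unfolding D_def B_def by (elim dvdE)
  have dD: "degree D = q" and dB: "degree B = q ^ m"
    unfolding D_def B_def using degree_monom_minus_x q2 qm by blast+
  have "B \<noteq> 0"
    using dB qm by (metis degree_0 not_numeral_le_zero)
  hence E0: "E \<noteq> 0"
    using BE by auto
  have D0: "D \<noteq> 0"
    using dD q2 by auto
  have "poly B x = 0" for x
    using finite_field_power_card[of x] card unfolding B_def by (simp add: poly_monom)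
  hence "UNIV = {x. poly D x = 0} \<union> {x. poly E x = 0}"
    using BE by auto
  hence "q ^ m \<le> card {x. poly D x = 0} + card {x. poly E x = 0}"
    using card card_Un_le by metis
  also have "\<dots> \<le> card {x. poly D x = 0} + degree E"
    using card_poly_roots_bound[OF E0] by simp
  finally have "q \<le> card {x. poly D x = 0}"
    using BE D0 E0 dD dB by (simp add: degree_mult_eq)
  thus ?thesis
    using card_Fq_le[OF qc] unfolding Fq_eq_roots D_def by simp
qed

section \<open>Linearized polynomials\<close>

lemma linearized_0 [simp]: "linearized q 0"
  unfolding linearized_def by simp

lemma linearized_monom: "linearized q (monom c (q ^ i))"
  unfolding linearized_def by auto

lemma linearized_x: "linearized q [:0, 1:]"
  using linearized_monom[of q 1 0] by (simp add: monom_altdef)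

lemma linearized_add: "linearized q f \<Longrightarrow> linearized q g \<Longrightarrow> linearized q (f + g)"
  unfolding linearized_def coeff_add by force

lemma linearized_uminus: "linearized q f \<Longrightarrow> linearized q (- f)"
  unfolding linearized_def by simp

lemma linearized_diff: "linearized q f \<Longrightarrow> linearized q g \<Longrightarrow> linearized q (f - g)"
  using linearized_add[of q f "-g"] linearized_uminus[of q g] by simp

lemma linearized_smult: "linearized q f \<Longrightarrow> linearized q (smult a f)"
  unfolding linearized_def by simp

lemma linearized_sum:
  "finite A \<Longrightarrow> (\<And>i. i \<in> A \<Longrightarrow> linearized q (f i)) \<Longrightarrow> linearized q (\<Sum>i\<in>A. f i)"
  by (induction A rule: finite_induct) (auto intro: linearized_add)

lemma coeff_sum_monom_q_power:
  assumes "finite A" "q \<ge> 2"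
  shows "coeff (\<Sum>i\<in>A. monom (c i) (q ^ i)) j = (if \<exists>i\<in>A. q ^ i = j then c (THE i. q ^ i = j) else 0)"
proof (cases "\<exists>i\<in>A. q ^ i = j")
  case True
  then obtain i0 where i0: "i0 \<in> A" "q ^ i0 = j"
    by auto
  have eq: "q ^ i = j \<longleftrightarrow> i = i0" for i
    using i0 assms(2) by auto
  have "coeff (\<Sum>i\<in>A. monom (c i) (q ^ i)) j = (\<Sum>i\<in>A. if i = i0 then c i else 0)"
    by (simp add: coeff_sum eq)
  also have "\<dots> = c i0"
    using i0 assms by simp
  finally show ?thesis
    using True eq by simp
next
  case False
  thus ?thesis
    by (auto simp: coeff_sum intro!: sum.neutral)
qed

lemma linearized_coeff_0: "q > 0 \<Longrightarrow> linearized q p \<Longrightarrow> coeff p 0 = 0"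
  unfolding linearized_def by (metis power_not_zero less_not_refl2)

lemma linearized_poly_0: "q > 0 \<Longrightarrow> linearized q p \<Longrightarrow> poly p 0 = 0"
  by (simp add: linearized_coeff_0 poly_0_coeff_0)

lemma pcompose_linearized_0: "q > 0 \<Longrightarrow> linearized q a \<Longrightarrow> pcompose a 0 = 0"
  by (simp add: pcompose_0' linearized_coeff_0)

lemma linearized_monom_expansion:
  assumes "q \<ge> 2" "linearized q p"
  shows "p = (\<Sum>i\<le>degree p. monom (coeff p (q ^ i)) (q ^ i))"
proof (rule poly_eqI)
  fix j
  show "coeff p j = coeff (\<Sum>i\<le>degree p. monom (coeff p (q ^ i)) (q ^ i)) j"
  proof (cases "coeff p j = 0")
    case True
    have "(\<Sum>i\<le>degree p. if q ^ i = j then coeff p (q ^ i) else 0) = 0"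
      using True by (intro sum.neutral) auto
    thus ?thesis
      using True by (simp add: coeff_sum)
  next
    case False
    then obtain i0 where i0: "j = q ^ i0"
      using assms(2) unfolding linearized_def by auto
    have "i0 < 2 ^ i0"
      by (rule less_exp)
    also have "(2::nat) ^ i0 \<le> q ^ i0"
      using assms(1) by (rule power_mono) simp
    also have "q ^ i0 \<le> degree p"
      using False i0 le_degree by blast
    finally have "i0 \<in> {..degree p}"
      by simp
    thus ?thesis
      using coeff_sum_monom_q_power[of "{..degree p}" q "\<lambda>i. coeff p (q ^ i)" j] assms(1) i0 by auto
  qed
qed

lemma linearized_sum_monom:
  assumes "finite A" "q \<ge> 2"
  shows "linearized q (\<Sum>i\<in>A. monom (c i) (q ^ i))"
  using assms by (intro linearized_sum linearized_monom)

lemma pcompose_monom: "pcompose (monom c n) f = smult c (f ^ n)"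
proof -
  have "pcompose ([:0, 1:] ^ n) f = f ^ n"
    by (induction n) (simp_all add: pcompose_mult pcompose_pCons pcompose_1)
  thus ?thesis
    by (simp add: monom_altdef pcompose_smult)
qed

lemma pcompose_linearized:
  assumes "q \<ge> 2" "linearized q p"
  shows "pcompose p f = (\<Sum>i\<le>degree p. smult (coeff p (q ^ i)) (f ^ (q ^ i)))"
  by (subst linearized_monom_expansion[OF assms]) (simp add: pcompose_sum pcompose_monom)

lemma poly_linearized:
  assumes "q \<ge> 2" "linearized q p"
  shows "poly p x = (\<Sum>i\<le>degree p. coeff p (q ^ i) * x ^ (q ^ i))"
  by (subst linearized_monom_expansion[OF assms]) (simp add: poly_sum poly_monom)

lemma linearized_power:
  assumes qc: "char_power q TYPE('a::field)" and f: "linearized q (f :: 'a poly)"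
  shows "linearized q (f ^ (q ^ i))"
proof -
  have "f ^ (q ^ i) = (\<Sum>j\<le>degree f. monom (coeff f (q ^ j)) (q ^ j)) ^ (q ^ i)"
    using linearized_monom_expansion[OF char_power_ge_2[OF qc] f] by simp
  also have "\<dots> = (\<Sum>j\<le>degree f. monom (coeff f (q ^ j) ^ (q ^ i)) (q ^ (j + i)))"
    by (simp add: frobenius_sum[OF char_power_poly[OF qc]] monom_power power_add)
  finally show ?thesis
    by (simp add: linearized_sum linearized_monom)
qed

lemma linearized_pcompose:
  assumes qc: "char_power q TYPE('a::field)" and "linearized q p" "linearized q (f :: 'a poly)"
  shows "linearized q (pcompose p f)"
  unfolding pcompose_linearized[OF char_power_ge_2[OF qc] assms(2)]
  by (intro linearized_sum linearized_smult linearized_power[OF qc assms(3)]) auto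

lemma pcompose_linearized_add:
  assumes qc: "char_power q TYPE('a::field)" and p: "linearized q p"
  shows "pcompose p (f + g :: 'a poly) = pcompose p f + pcompose p g"
  using char_power_ge_2[OF qc]
  by (simp add: pcompose_linearized[OF _ p] frobenius_add[OF char_power_poly[OF qc]]
      smult_add_right sum.distrib)

lemma pcompose_linearized_uminus:
  assumes qc: "char_power q TYPE('a::field)" and p: "linearized q p"
  shows "pcompose p (- f :: 'a poly) = - pcompose p f"
  using char_power_ge_2[OF qc]
  by (simp add: pcompose_linearized[OF _ p] frobenius_minus[OF char_power_poly[OF qc]] sum_negf)

lemma pcompose_linearized_diff:
  assumes qc: "char_power q TYPE('a::field)" and p: "linearized q p"
  shows "pcompose p (f - g :: 'a poly) = pcompose p f - pcompose p g"
  using pcompose_linearized_add[OF qc p, of f "-g"] pcompose_linearized_uminus[OF qc p, of g] by simp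

lemma poly_linearized_add:
  assumes qc: "char_power q TYPE('a::field)" and p: "linearized q p"
  shows "poly p (a + b :: 'a) = poly p a + poly p b"
  using char_power_ge_2[OF qc]
  by (simp add: poly_linearized[OF _ p] frobenius_add[OF qc] distrib_left sum.distrib)

lemma poly_linearized_uminus:
  assumes qc: "char_power q TYPE('a::field)" and p: "linearized q p"
  shows "poly p (- a :: 'a) = - poly p a"
  using char_power_ge_2[OF qc]
  by (simp add: poly_linearized[OF _ p] frobenius_minus[OF qc] sum_negf)

lemma poly_linearized_diff:
  assumes qc: "char_power q TYPE('a::field)" and p: "linearized q p"
  shows "poly p (a - b :: 'a) = poly p a - poly p b"
  using poly_linearized_add[OF qc p, of a "-b"] poly_linearized_uminus[OF qc p, of b] by simp

lemma poly_linearized_Fq_mult: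
  assumes qc: "char_power q TYPE('a::field)" and p: "linearized q p" and c: "c \<in> Fq q"
  shows "poly p (c * a :: 'a) = c * poly p a"
  using char_power_ge_2[OF qc]
  by (simp add: poly_linearized[OF _ p] power_mult_distrib Fq_power_q_power[OF c]
      sum_distrib_left mult_ac)

lemma poly_linearized_Fq_comb:
  assumes qc: "char_power q TYPE('a::field)" and p: "linearized q p"
    and "finite A" "\<And>i. i \<in> A \<Longrightarrow> c i \<in> Fq q"
  shows "poly p (\<Sum>i\<in>A. c i * x i :: 'a) = (\<Sum>i\<in>A. c i * poly p (x i))"
  using assms(3,4)
proof (induction A rule: finite_induct)
  case empty
  thus ?case
    using linearized_poly_0[OF _ p] char_power_ge_2[OF qc] by simp
next
  case (insert a A)
  thus ?case
    by (simp add: poly_linearized_add[OF qc p] poly_linearized_Fq_mult[OF qc p])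
qed

lemma degree_linearized:
  assumes "q \<ge> 2" "linearized q p" "p \<noteq> 0"
  shows "degree p = q ^ qdeg q p"
proof -
  obtain i where i: "degree p = q ^ i"
    using assms(2,3) unfolding linearized_def by (metis leading_coeff_0_iff)
  have "qdeg q p = i"
    unfolding qdeg_def by (rule the_equality) (use i assms(1) in auto)
  thus ?thesis
    using i by simp
qed

lemma qdeg_eqI: "q \<ge> 2 \<Longrightarrow> degree p = q ^ d \<Longrightarrow> qdeg q p = d"
  unfolding qdeg_def by (rule the_equality) auto

lemma degree_linearized_pos: "q \<ge> 2 \<Longrightarrow> linearized q p \<Longrightarrow> p \<noteq> 0 \<Longrightarrow> degree p \<ge> 1"
  using degree_linearized[of q p] by simp

lemma degree_linearized_le_q_power:
  assumes q2: "q \<ge> 2" and f: "linearized q f" and d: "degree f < q ^ k"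
  shows "degree f \<le> q ^ (k - 1)"
proof (cases "f = 0")
  case False
  have "q ^ qdeg q f < q ^ k"
    using degree_linearized[OF q2 f False] d by simp
  hence "qdeg q f < k"
    using q2 by simp
  hence "q ^ qdeg q f \<le> q ^ (k - 1)"
    using q2 by (intro power_increasing) auto
  thus ?thesis
    using degree_linearized[OF q2 f False] by simp
qed simp

lemma coeff_linearized_nonzero_le_qdeg:
  assumes "q \<ge> 2" "linearized q p" "coeff p (q ^ i) \<noteq> 0"
  shows "i \<le> qdeg q p"
proof -
  have "q ^ i \<le> q ^ qdeg q p"
    using le_degree[OF assms(3)] degree_linearized[OF assms(1,2)] assms(3) by fastforce
  thus ?thesis
    using assms(1) by simp
qed

lemma coeff_linearized_qdeg:
  assumes "q \<ge> 2" "linearized q p" "p \<noteq> 0"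
  shows "coeff p (q ^ qdeg q p) \<noteq> 0"
  using degree_linearized[OF assms] assms(3) by (metis leading_coeff_0_iff)

section \<open>Leading positions and weighted degrees\<close>

lemma mon_less_asym: "mon_less k a b \<Longrightarrow> \<not> mon_less k b a"
  unfolding mon_less_def by auto

lemma lm_idx_eqI:
  assumes "m \<in> supp q f" "\<And>m'. m' \<in> supp q f \<Longrightarrow> m' \<noteq> m \<Longrightarrow> mon_less k m' m"
  shows "lm_idx q k f = m"
  unfolding lm_idx_def
proof (rule the_equality)
  show "m \<in> supp q f \<and> (\<forall>m'\<in>supp q f. m' \<noteq> m \<longrightarrow> mon_less k m' m)"
    using assms by auto
  fix m'' assume "m'' \<in> supp q f \<and> (\<forall>m'\<in>supp q f. m' \<noteq> m'' \<longrightarrow> mon_less k m' m'')"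
  thus "m'' = m"
    using assms mon_less_asym by metis
qed

lemma lm_idx_first:
  assumes q2: "q \<ge> 2" and l1: "linearized q f1" and l2: "linearized q f2"
    and f1: "f1 \<noteq> 0" and c: "f2 = 0 \<or> qdeg q f2 + (k - 1) < qdeg q f1"
  shows "lm_idx q k (f1, f2) = (qdeg q f1, 1)"
proof (rule lm_idx_eqI)
  show "(qdeg q f1, 1) \<in> supp q (f1, f2)"
    unfolding supp_def comp_of_def using coeff_linearized_qdeg[OF q2 l1 f1] by auto
  fix m' assume m': "m' \<in> supp q (f1, f2)" "m' \<noteq> (qdeg q f1, 1)"
  obtain i j where ij: "m' = (i, j)"
    by fastforce
  show "mon_less k m' (qdeg q f1, 1)"
  proof (cases "j = 1")
    case True
    hence "i \<le> qdeg q f1"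
      using m' ij coeff_linearized_nonzero_le_qdeg[OF q2 l1] unfolding supp_def comp_of_def by auto
    thus ?thesis
      using m' ij True unfolding mon_less_def wt_def by auto
  next
    case False
    hence "j = 2" and ci: "coeff f2 (q ^ i) \<noteq> 0"
      using m' ij unfolding supp_def comp_of_def by auto
    moreover have "i + (k - 1) < qdeg q f1"
      using coeff_linearized_nonzero_le_qdeg[OF q2 l2 ci] c ci by auto
    ultimately show ?thesis
      using ij unfolding mon_less_def wt_def by auto
  qed
qed

lemma lm_idx_second:
  assumes q2: "q \<ge> 2" and l1: "linearized q f1" and l2: "linearized q f2"
    and f2: "f2 \<noteq> 0" and c: "f1 = 0 \<or> qdeg q f1 \<le> qdeg q f2 + (k - 1)"
  shows "lm_idx q k (f1, f2) = (qdeg q f2, 2)"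
proof (rule lm_idx_eqI)
  show "(qdeg q f2, 2) \<in> supp q (f1, f2)"
    unfolding supp_def comp_of_def using coeff_linearized_qdeg[OF q2 l2 f2] by auto
  fix m' assume m': "m' \<in> supp q (f1, f2)" "m' \<noteq> (qdeg q f2, 2)"
  obtain i j where ij: "m' = (i, j)"
    by fastforce
  show "mon_less k m' (qdeg q f2, 2)"
  proof (cases "j = 1")
    case True
    hence ci: "coeff f1 (q ^ i) \<noteq> 0"
      using m' ij unfolding supp_def comp_of_def by auto
    have "i \<le> qdeg q f2 + (k - 1)"
      using coeff_linearized_nonzero_le_qdeg[OF q2 l1 ci] c ci by auto
    thus ?thesis
      using ij True unfolding mon_less_def wt_def by auto
  next
    case False
    hence "j = 2" and "i \<le> qdeg q f2"
      using m' ij coeff_linearized_nonzero_le_qdeg[OF q2 l2] unfolding supp_def comp_of_def by auto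
    thus ?thesis
      using m' ij unfolding mon_less_def wt_def by auto
  qed
qed

lemma lpos_1_D:
  assumes "q \<ge> 2" "linearized q f1" "linearized q f2" "(f1, f2) \<noteq> (0, 0)" "lpos q k (f1, f2) = 1"
  shows "f1 \<noteq> 0" "f2 = 0 \<or> qdeg q f2 + (k - 1) < qdeg q f1"
  using assms lm_idx_second[OF assms(1-3), of k] unfolding lpos_def by force+

lemma lpos_2_D:
  assumes "q \<ge> 2" "linearized q f1" "linearized q f2" "(f1, f2) \<noteq> (0, 0)" "lpos q k (f1, f2) = 2"
  shows "f2 \<noteq> 0" "f1 = 0 \<or> qdeg q f1 \<le> qdeg q f2 + (k - 1)"
  using assms lm_idx_first[OF assms(1-3), of k] unfolding lpos_def by force+

lemma wqdeg_first:
  assumes "f1 \<noteq> 0" "f2 = 0 \<or> qdeg q f2 + (k - 1) < qdeg q f1"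
  shows "wqdeg q k (f1, f2) = qdeg q f1"
  using assms unfolding wqdeg_def by (cases "f2 = 0") auto

lemma wqdeg_second:
  assumes "f2 \<noteq> 0" "f1 = 0 \<or> qdeg q f1 \<le> qdeg q f2 + (k - 1)"
  shows "wqdeg q k (f1, f2) = qdeg q f2 + (k - 1)"
  using assms unfolding wqdeg_def by (cases "f1 = 0") (auto simp: max_def)

text \<open>The leading positions, restated through ordinary degrees with the weight \<open>K = q^(k-1)\<close>.\<close>

definition leads_in_first :: "nat \<Rightarrow> 'a::zero poly \<times> 'a poly \<Rightarrow> bool" where
  "leads_in_first K v \<longleftrightarrow> fst v \<noteq> 0 \<and> (snd v = 0 \<or> degree (snd v) * K < degree (fst v))"

definition leads_in_second :: "nat \<Rightarrow> 'a::zero poly \<times> 'a poly \<Rightarrow> bool" where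
  "leads_in_second K u \<longleftrightarrow> snd u \<noteq> 0 \<and> degree (fst u) \<le> degree (snd u) * K"

lemma leads_in_first_if_lpos_1:
  assumes q2: "q \<ge> 2" and lin: "linearized q v1" "linearized q v2"
    and "(v1, v2) \<noteq> (0, 0)" "lpos q k (v1, v2) = 1"
  shows "leads_in_first (q ^ (k - 1)) (v1, v2)"
proof -
  note lp = lpos_1_D[OF q2 lin assms(4,5)]
  have "degree v2 * q ^ (k - 1) < degree v1" if "v2 \<noteq> 0"
  proof -
    have "q ^ (qdeg q v2 + (k - 1)) < q ^ qdeg q v1"
      using lp(2) that q2 by simp
    thus ?thesis
      using degree_linearized[OF q2 lin(1) lp(1)] degree_linearized[OF q2 lin(2) that]
      by (simp add: power_add)
  qed
  thus ?thesis
    unfolding leads_in_first_def using lp(1) by auto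
qed

lemma leads_in_second_if_lpos_2:
  assumes q2: "q \<ge> 2" and lin: "linearized q u1" "linearized q u2"
    and "(u1, u2) \<noteq> (0, 0)" "lpos q k (u1, u2) = 2"
  shows "leads_in_second (q ^ (k - 1)) (u1, u2)"
proof -
  note lp = lpos_2_D[OF q2 lin assms(4,5)]
  have "degree u1 \<le> degree u2 * q ^ (k - 1)" if "u1 \<noteq> 0"
  proof -
    have "q ^ qdeg q u1 \<le> q ^ (qdeg q u2 + (k - 1))"
      using lp(2) that q2 by (intro power_increasing) auto
    thus ?thesis
      using degree_linearized[OF q2 lin(1) that] degree_linearized[OF q2 lin(2) lp(1)]
      by (simp add: power_add)
  qed
  thus ?thesis
    unfolding leads_in_second_def using lp(1) by fastforce
qed

section \<open>The predictable degree property\<close>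

context
  fixes q K :: nat and a1 a2 v1 v2 u1 u2 :: "'a::field poly"
  assumes q2: "q \<ge> 2"
    and lin: "linearized q a1" "linearized q a2" "linearized q v1" "linearized q u2"
    and v: "leads_in_first K (v1, v2)" and u: "leads_in_second K (u1, u2)"
begin

lemma lcomb_leads_in_second:
  assumes a2: "a2 \<noteq> 0" and dom: "a1 = 0 \<or> degree a1 * degree v1 \<le> degree a2 * degree u2 * K"
  shows "leads_in_second K (vadd (lcomp a1 (v1, v2)) (lcomp a2 (u1, u2)))
    \<and> degree (pcompose a1 v2 + pcompose a2 u2) = degree a2 * degree u2"
proof -
  have da2: "degree a2 \<ge> 1" and du2: "degree u2 \<ge> 1"
    using degree_linearized_pos[OF q2] lin(2,4) a2 u unfolding leads_in_second_def by auto
  have "degree (pcompose a1 v2) < degree (pcompose a2 u2)"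
  proof (cases "a1 = 0 \<or> v2 = 0")
    case True
    hence "pcompose a1 v2 = 0"
      using pcompose_linearized_0[OF _ lin(1)] q2 by auto
    thus ?thesis
      using da2 du2 by (simp add: degree_pcompose)
  next
    case False
    hence "degree v2 * K < degree v1" and h2: "degree a1 * degree v1 \<le> degree a2 * degree u2 * K"
      using v dom unfolding leads_in_first_def by auto
    moreover have "degree a1 \<ge> 1"
      using degree_linearized_pos[OF q2 lin(1)] False by auto
    ultimately have h1: "degree a1 * (degree v2 * K) < degree a1 * degree v1"
      by simp
    have "(degree a1 * degree v2) * K < (degree a2 * degree u2) * K"
      using order.strict_trans2[OF h1 h2] by (simp add: mult_ac)
    hence "degree a1 * degree v2 < degree a2 * degree u2"
      by simp
    thus ?thesis
      by (simp add: degree_pcompose)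
  qed
  hence d2: "degree (pcompose a1 v2 + pcompose a2 u2) = degree a2 * degree u2"
    by (simp add: degree_add_eq_right degree_pcompose)
  have "degree (pcompose a1 v1) \<le> degree a2 * degree u2 * K"
    using dom by (auto simp: degree_pcompose)
  moreover have "degree (pcompose a2 u1) \<le> degree a2 * degree u2 * K"
    using u unfolding leads_in_second_def by (simp add: degree_pcompose mult.assoc)
  ultimately have "degree (pcompose a1 v1 + pcompose a2 u1) \<le> degree a2 * degree u2 * K"
    by (rule degree_add_le)
  moreover have "pcompose a1 v2 + pcompose a2 u2 \<noteq> 0"
    using d2 da2 du2 by (metis degree_0 mult_is_0 not_one_le_zero)
  ultimately show ?thesis
    using d2 unfolding leads_in_second_def vadd_def lcomp_def by simp
qed

lemma lcomb_leads_in_first: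
  assumes a1: "a1 \<noteq> 0" and dom: "a2 = 0 \<or> degree a2 * degree u2 * K < degree a1 * degree v1"
  shows "leads_in_first K (vadd (lcomp a1 (v1, v2)) (lcomp a2 (u1, u2)))
    \<and> degree (pcompose a1 v1 + pcompose a2 u1) = degree a1 * degree v1"
proof -
  have v1: "v1 \<noteq> 0" and v2: "v2 = 0 \<or> degree v2 * K < degree v1"
    using v unfolding leads_in_first_def by auto
  have pos: "degree a1 * degree v1 \<ge> 1"
    using degree_linearized_pos[OF q2 lin(1) a1] degree_linearized_pos[OF q2 lin(3) v1] by simp
  have "degree (pcompose a2 u1) < degree (pcompose a1 v1)"
  proof (cases "a2 = 0")
    case True
    thus ?thesis
      using pos by (simp add: degree_pcompose)
  next
    case False
    have "degree a2 * degree u1 \<le> degree a2 * degree u2 * K"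
      using u unfolding leads_in_second_def by (simp add: mult.assoc)
    hence "degree a2 * degree u1 < degree a1 * degree v1"
      using dom False by linarith
    thus ?thesis
      by (simp add: degree_pcompose)
  qed
  hence d1: "degree (pcompose a1 v1 + pcompose a2 u1) = degree a1 * degree v1"
    by (simp add: degree_add_eq_left degree_pcompose)
  have "degree (pcompose a1 v2) * K < degree a1 * degree v1"
  proof (cases "v2 = 0")
    case True
    thus ?thesis
      using pos pcompose_linearized_0[OF _ lin(1)] q2 by simp
  next
    case False
    hence "degree a1 * (degree v2 * K) < degree a1 * degree v1"
      using v2 pos by simp
    thus ?thesis
      by (simp add: degree_pcompose mult_ac)
  qed
  moreover have "degree (pcompose a2 u2) * K < degree a1 * degree v1"
    using dom pos by (auto simp: degree_pcompose)
  ultimately have "max (degree (pcompose a1 v2)) (degree (pcompose a2 u2)) * K < degree a1 * degree v1"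
    by (simp add: max_def)
  hence "degree (pcompose a1 v2 + pcompose a2 u2) * K < degree a1 * degree v1"
    using mult_le_mono1[OF degree_add_le_max[of "pcompose a1 v2" "pcompose a2 u2"], of K] by linarith
  thus ?thesis
    using d1 pos unfolding leads_in_first_def vadd_def lcomp_def by auto
qed

theorem predictable_degree:
  obtains "a1 = 0" "a2 = 0"
  | "a2 \<noteq> 0" "leads_in_second K (vadd (lcomp a1 (v1, v2)) (lcomp a2 (u1, u2)))"
      "degree (pcompose a1 v2 + pcompose a2 u2) = degree a2 * degree u2"
  | "a1 \<noteq> 0" "leads_in_first K (vadd (lcomp a1 (v1, v2)) (lcomp a2 (u1, u2)))"
      "degree (pcompose a1 v1 + pcompose a2 u1) = degree a1 * degree v1"
  using lcomb_leads_in_second lcomb_leads_in_first by linarith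

end

section \<open>\<open>\<bbbF>\<^sub>q\<close>-spans and subspace polynomials\<close>

definition Fq_span_on :: "nat \<Rightarrow> 'i set \<Rightarrow> ('i \<Rightarrow> 'a::field) \<Rightarrow> 'a set" where
  "Fq_span_on q I w = {(\<Sum>i\<in>I. c i * w i) | c. \<forall>i\<in>I. c i \<in> Fq q}"

lemma Fq_span_eq: "Fq_span q n g = Fq_span_on q {..<n} g"
  unfolding Fq_span_def Fq_span_on_def by auto

lemma Fq_span_on_generator:
  assumes "q > 0" "finite I" "i \<in> I"
  shows "w i \<in> Fq_span_on q I w"
proof -
  have "(\<Sum>j\<in>I. (if j = i then 1 else 0) * w j) = (\<Sum>j\<in>I. if j = i then w j else 0)"
    by (rule sum.cong) auto
  hence "w i = (\<Sum>j\<in>I. (if j = i then 1 else 0) * w j)"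
    using assms(2,3) by simp
  moreover have "\<forall>j\<in>I. (if j = i then 1 else 0) \<in> Fq q"
    using Fq_zero[OF assms(1)] Fq_one by auto
  ultimately show ?thesis
    unfolding Fq_span_on_def by (intro CollectI exI[of _ "\<lambda>j. if j = i then 1 else 0"]) simp
qed

lemma linearized_vanishes_on_span:
  assumes qc: "char_power q TYPE('a::field)" and A: "linearized q A" and "finite I"
    and "\<And>i. i \<in> I \<Longrightarrow> poly A (w i) = (0::'a)" and "u \<in> Fq_span_on q I w"
  shows "poly A u = 0"
proof -
  obtain c where "u = (\<Sum>i\<in>I. c i * w i)" and "\<forall>i\<in>I. c i \<in> Fq q"
    using assms(5) unfolding Fq_span_on_def by auto
  thus ?thesis
    using poly_linearized_Fq_comb[OF qc A \<open>finite I\<close>, of c w] assms(4) by simp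
qed

lemma card_Fq_span_on:
  assumes qc: "char_power q TYPE('a::field)" and fin: "finite I" and ind: "Fq_indep q I w"
  shows "card (Fq_span_on q I w :: 'a set) = card (Fq q :: 'a set) ^ card I"
proof -
  let ?P = "PiE I (\<lambda>_. Fq q :: 'a set)"
  let ?f = "\<lambda>c. (\<Sum>i\<in>I. c i * w i)"
  have img: "Fq_span_on q I w = ?f ` ?P"
  proof
    show "Fq_span_on q I w \<subseteq> ?f ` ?P"
    proof
      fix u assume "u \<in> Fq_span_on q I w"
      then obtain c where u: "u = ?f c" and c: "\<forall>i\<in>I. c i \<in> Fq q"
        unfolding Fq_span_on_def by auto
      have "restrict c I \<in> ?P"
        using c by auto
      moreover have "u = ?f (restrict c I)"
        using u by simp
      ultimately show "u \<in> ?f ` ?P"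
        by blast
    qed
    show "?f ` ?P \<subseteq> Fq_span_on q I w"
      unfolding Fq_span_on_def by (auto simp: PiE_def Pi_def)
  qed
  have inj: "inj_on ?f ?P"
  proof (rule inj_onI)
    fix c d assume c: "c \<in> ?P" and d: "d \<in> ?P" and eq: "?f c = ?f d"
    have "(\<Sum>i\<in>I. (c i - d i) * w i) = 0"
      using eq by (simp add: left_diff_distrib sum_subtractf)
    moreover have "\<forall>i\<in>I. c i - d i \<in> Fq q"
      using c d Fq_diff[OF qc] by (auto simp: PiE_def Pi_def)
    ultimately have "(\<forall>i\<in>I. c i - d i \<in> Fq q) \<and> (\<Sum>i\<in>I. (c i - d i) * w i) = 0"
      by blast
    hence "\<forall>i\<in>I. c i - d i = 0"
      by (rule ind[unfolded Fq_indep_def, THEN spec, THEN mp])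
    thus "c = d"
      by (auto intro: PiE_ext[OF c d])
  qed
  have "card (Fq_span_on q I w) = card ?P"
    unfolding img using card_image[OF inj] .
  also have "\<dots> = card (Fq q :: 'a set) ^ card I"
    using fin by (simp add: card_PiE)
  finally show ?thesis .
qed

text \<open>A vanishing combination of the new vectors is a combination of the \<open>w\<^sub>i\<close> whose coefficients at
  \<open>j \<notin> S\<close> are the original ones.\<close>

lemma Fq_indep_eliminate:
  assumes qc: "char_power q TYPE('a::field)" and ind: "Fq_indep q {..<n} (w :: nat \<Rightarrow> 'a)"
    and S: "S \<subseteq> {..<n}" and a: "\<And>j l. j \<in> {..<n} - S \<Longrightarrow> l \<in> S \<Longrightarrow> a j l \<in> Fq q"
  shows "Fq_indep q ({..<n} - S) (\<lambda>j. w j - (\<Sum>l\<in>S. a j l * w l))"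
  unfolding Fq_indep_def
proof (intro allI impI ballI)
  fix c j
  assume c: "(\<forall>i\<in>{..<n} - S. c i \<in> Fq q) \<and> (\<Sum>i\<in>{..<n} - S. c i * (w i - (\<Sum>l\<in>S. a i l * w l))) = 0"
    and j: "j \<in> {..<n} - S"
  define J where "J = {..<n} - S"
  define coef where "coef l = (if l \<in> J then c l else - (\<Sum>i\<in>J. c i * a i l))" for l
  have finS: "finite S" and finJ: "finite J" and JS: "{..<n} = J \<union> S" "J \<inter> S = {}"
    using S finite_subset unfolding J_def by auto
  have "(\<Sum>l\<in>S. coef l * w l) = (\<Sum>l\<in>S. - ((\<Sum>i\<in>J. c i * a i l) * w l))"
    unfolding coef_def using JS(2) by (intro sum.cong) auto
  also have "\<dots> = - (\<Sum>l\<in>S. \<Sum>i\<in>J. c i * a i l * w l)"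
    by (simp add: sum_negf sum_distrib_right)
  also have "(\<Sum>l\<in>S. \<Sum>i\<in>J. c i * a i l * w l) = (\<Sum>i\<in>J. c i * (\<Sum>l\<in>S. a i l * w l))"
    by (subst sum.swap) (simp add: sum_distrib_left mult.assoc)
  finally have sumS: "(\<Sum>l\<in>S. coef l * w l) = - (\<Sum>i\<in>J. c i * (\<Sum>l\<in>S. a i l * w l))" .
  have "(\<Sum>l<n. coef l * w l) = (\<Sum>l\<in>J. coef l * w l) + (\<Sum>l\<in>S. coef l * w l)"
    unfolding JS(1) by (rule sum.union_disjoint[OF finJ finS JS(2)])
  also have "\<dots> = (\<Sum>i\<in>J. c i * (w i - (\<Sum>l\<in>S. a i l * w l)))"
    unfolding sumS by (simp add: coef_def right_diff_distrib sum_subtractf)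
  finally have "(\<Sum>l<n. coef l * w l) = 0"
    using c unfolding J_def by simp
  moreover have "coef l \<in> Fq q" if "l < n" for l
  proof (cases "l \<in> J")
    case False
    have "(\<Sum>i\<in>J. c i * a i l) \<in> Fq q"
      using c a False that unfolding J_def by (intro Fq_sum[OF qc] Fq_mult) auto
    thus ?thesis
      using False unfolding coef_def by (simp add: Fq_uminus[OF qc])
  qed (use c in \<open>simp add: coef_def J_def\<close>)
  ultimately have "(\<forall>l\<in>{..<n}. coef l \<in> Fq q) \<and> (\<Sum>l<n. coef l * w l) = 0"
    by blast
  hence "\<forall>l\<in>{..<n}. coef l = 0"
    by (rule ind[unfolded Fq_indep_def, THEN spec, THEN mp])
  hence "coef j = 0"
    using j by blast
  thus "c j = 0"
    using j unfolding coef_def J_def by simp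
qed

lemma card_le_degree_if_roots:
  fixes p :: "'a::idom poly"
  assumes "p \<noteq> 0" "\<forall>u\<in>U. poly p u = 0"
  shows "card U \<le> degree p"
proof -
  have "card U \<le> card {x. poly p x = 0}"
    using assms by (intro card_mono poly_roots_finite) auto
  also have "\<dots> \<le> degree p"
    by (rule card_poly_roots_bound[OF assms(1)])
  finally show ?thesis .
qed

lemma monic_annihilator_exists:
  assumes qc: "char_power q TYPE('a::field)" and "finite I"
  shows "\<exists>A. linearized q A \<and> lead_coeff A = 1 \<and> degree A = q ^ card I
    \<and> (\<forall>i\<in>I. poly A (w i :: 'a) = 0)"
  using \<open>finite I\<close>
proof (induction I rule: finite_induct)
  case empty
  show ?case
    by (rule exI[of _ "[:0, 1:]"]) (simp add: linearized_x)
next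
  case (insert a I)
  have q2: "q \<ge> 2"
    using char_power_ge_2[OF qc] .
  obtain A where A: "linearized q A" "lead_coeff A = 1" "degree A = q ^ card I"
    "\<forall>i\<in>I. poly A (w i) = 0"
    using insert.IH by blast
  define \<beta> where "\<beta> = poly A (w a)"
  txt \<open>\<open>P = x^q - \<beta>^(q-1) x\<close> vanishes on \<open>\<beta>\<close>, so \<open>P \<circ> A\<close> also kills \<open>w a\<close>.\<close>
  define P :: "'a poly" where "P = monom 1 (q ^ 1) - monom (\<beta> ^ (q - 1)) (q ^ 0)"
  have linP: "linearized q P"
    unfolding P_def by (intro linearized_diff linearized_monom)
  have dP: "degree P = q"
  proof (rule antisym)
    show "degree P \<le> q"
      unfolding P_def using q2 by (intro degree_diff_le) (auto intro: order.trans[OF degree_monom_le])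
    show "q \<le> degree P"
      unfolding P_def using q2 by (intro le_degree) simp
  qed
  hence lP: "lead_coeff P = 1"
    unfolding P_def using q2 by simp
  have poly_P: "poly P x = x ^ q - \<beta> ^ (q - 1) * x" for x
    unfolding P_def by (simp add: poly_monom)
  have "\<beta> ^ (q - 1) * \<beta> = \<beta> ^ q"
    using q2 by (simp flip: power_Suc2)
  hence "poly P \<beta> = 0" "poly P 0 = 0"
    using poly_P q2 by simp_all
  moreover have "degree A > 0"
    using A(3) q2 by simp
  ultimately show ?case
    using A insert.hyps lead_coeff_comp[of A P] lP linearized_pcompose[OF qc linP A(1)]
    by (intro exI[of _ "pcompose P A"]) (auto simp: poly_pcompose degree_pcompose dP \<beta>_def)
qed

lemma prod_roots_dvd:
  fixes p :: "'a::field poly"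
  shows "finite S \<Longrightarrow> (\<forall>s\<in>S. poly p s = 0) \<Longrightarrow> (\<Prod>s\<in>S. [:- s, 1:]) dvd p"
proof (induction S arbitrary: p rule: finite_induct)
  case (insert a S)
  have "(\<Prod>s\<in>S. [:- s, 1:]) dvd p"
    using insert.IH insert.prems by simp
  then obtain r where r: "p = (\<Prod>s\<in>S. [:- s, 1:]) * r"
    by (elim dvdE)
  have "poly (\<Prod>s\<in>S. [:- s, 1:]) a \<noteq> 0"
    using insert.hyps by (auto simp: poly_prod)
  hence "poly r a = 0"
    using insert.prems r by simp
  hence "[:- a, 1:] dvd r"
    by (simp add: poly_eq_0_iff_dvd)
  then obtain r' where r': "r = [:- a, 1:] * r'"
    by (elim dvdE)
  have "p = (\<Prod>s\<in>insert a S. [:- s, 1:]) * r'"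
    unfolding prod.insert[OF insert.hyps] r r' by (simp only: ac_simps)
  thus ?case
    by simp
qed simp

lemma monic_dvd_eq:
  fixes P A :: "'a::field poly"
  assumes "P dvd A" "lead_coeff P = 1" "lead_coeff A = 1" "degree P = degree A"
  shows "P = A"
proof -
  obtain r where r: "A = P * r"
    using assms(1) by (elim dvdE)
  have "A \<noteq> 0"
    using assms(3) by auto
  hence "r \<noteq> 0" "P \<noteq> 0"
    using r by auto
  hence "degree A = degree P + degree r"
    using r degree_mult_eq by blast
  hence "degree r = 0"
    using assms(4) by simp
  then obtain c where c: "r = [:c:]"
    using degree_eq_zeroE by blast
  have "lead_coeff A = lead_coeff P * c"
    using r c by (simp add: lead_coeff_mult)
  hence "c = 1"
    using assms(2,3) by simp
  thus ?thesis
    using r c by simp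
qed

context
  fixes q n :: nat and g :: "nat \<Rightarrow> 'a::{field,finite}"
  assumes qc: "char_power q TYPE('a)" and cq: "card (Fq q :: 'a set) = q"
    and ind: "Fq_indep q {..<n} g"
begin

lemma card_Fq_span: "card (Fq_span q n g) = q ^ n"
  unfolding Fq_span_eq using card_Fq_span_on[OF qc _ ind] cq by simp

lemma lead_coeff_Pi_poly: "lead_coeff (Pi_poly q n g) = 1"
  unfolding Pi_poly_def by (simp add: lead_coeff_prod)

lemma degree_Pi_poly: "degree (Pi_poly q n g) = q ^ n"
  unfolding Pi_poly_def by (subst degree_prod_sum_eq) (auto simp: card_Fq_span)

lemma poly_Pi_poly_span: "u \<in> Fq_span q n g \<Longrightarrow> poly (Pi_poly q n g) u = 0"
  unfolding Pi_poly_def by (auto simp: poly_prod)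

text \<open>\<open>\<Pi>\<^sub>g\<close> is the monic annihilator of the \<open>g\<^sub>i\<close>, which is linearized.\<close>

lemma linearized_Pi_poly: "linearized q (Pi_poly q n g)"
proof -
  obtain A where A: "linearized q A" "lead_coeff A = 1" "degree A = q ^ n" "\<forall>i<n. poly A (g i) = 0"
    using monic_annihilator_exists[OF qc, of "{..<n}" g] by auto
  have "\<forall>u\<in>Fq_span q n g. poly A u = 0"
    unfolding Fq_span_eq using linearized_vanishes_on_span[OF qc A(1), of "{..<n}" g] A(4) by auto
  hence "Pi_poly q n g dvd A"
    unfolding Pi_poly_def by (intro prod_roots_dvd) auto
  moreover have "degree (Pi_poly q n g) = degree A"
    using degree_Pi_poly A(3) by simp
  ultimately have "Pi_poly q n g = A"
    by (rule monic_dvd_eq[OF _ lead_coeff_Pi_poly A(2)])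
  thus ?thesis
    using A(1) by simp
qed

end

text \<open>Division on the right: subtracting \<open>c x^(q^(d-n)) \<circ> P\<close> lowers the degree of \<open>A\<close>, and a remainder of
  degree below \<open>q^n\<close> cannot vanish on the \<open>q^n\<close> points of \<open>U\<close>.\<close>

lemma linearized_right_factor:
  assumes qc: "char_power q TYPE('a::field)" and linP: "linearized q P" and lP: "lead_coeff P = 1"
    and dP: "degree P = q ^ n" and PU: "\<forall>u\<in>U. poly P u = 0" and cU: "card U = q ^ n"
    and "linearized q A" "\<forall>u\<in>U. poly A u = (0::'a)"
  shows "\<exists>\<beta>. linearized q \<beta> \<and> A = pcompose \<beta> P"
  using assms(7,8)
proof (induction "degree A" arbitrary: A rule: less_induct)
  case less
  have q2: "q \<ge> 2"
    using char_power_ge_2[OF qc] .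
  show ?case
  proof (cases "A = 0")
    case True
    thus ?thesis
      by (intro exI[of _ 0]) simp
  next
    case False
    define d where "d = qdeg q A"
    have dA: "degree A = q ^ d"
      using degree_linearized[OF q2 less.prems(1) False] d_def by simp
    have "q ^ n \<le> q ^ d"
      using card_le_degree_if_roots[OF False less.prems(2)] cU dA by simp
    hence dn: "n \<le> d"
      using q2 by simp
    define c where "c = lead_coeff A"
    define B where "B = pcompose (monom c (q ^ (d - n))) P"
    have c0: "c \<noteq> 0"
      using False c_def by simp
    have "degree B = q ^ (d - n) * q ^ n"
      unfolding B_def by (simp add: degree_pcompose degree_monom_eq[OF c0] dP)
    hence dB: "degree B = q ^ d"
      using dn by (simp flip: power_add)
    have lB: "lead_coeff B = c"
      unfolding B_def by (simp add: pcompose_monom lead_coeff_power lP)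
    have "degree (A - B) < degree A"
    proof (cases "A - B = 0")
      case True
      thus ?thesis
        using dA q2 by simp
    next
      case False
      have "coeff (A - B) (q ^ d) = 0"
        using dA dB lB c_def by simp
      hence "degree (A - B) \<noteq> q ^ d"
        using False by (metis leading_coeff_0_iff)
      moreover have "degree (A - B) \<le> q ^ d"
        by (intro degree_diff_le) (simp_all add: dA dB)
      ultimately show ?thesis
        using dA by simp
    qed
    moreover have "linearized q (A - B)"
      unfolding B_def by (intro linearized_diff less.prems(1) linearized_pcompose[OF qc linearized_monom linP])
    moreover have "\<forall>u\<in>U. poly (A - B) u = 0"
      unfolding B_def using less.prems(2) PU q2 by (simp add: poly_pcompose poly_monom)
    ultimately obtain \<beta> where "linearized q \<beta>" "A - B = pcompose \<beta> P"
      using less.hyps by blast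
    thus ?thesis
      unfolding B_def
      by (intro exI[of _ "\<beta> + monom c (q ^ (d - n))"])
        (simp add: linearized_add linearized_monom pcompose_add algebra_simps)
  qed
qed

section \<open>The Moore matrix and the interpolation polynomial\<close>

lemma moore_carrier: "moore q n g \<in> carrier_mat n n"
  unfolding moore_def by simp

lemma degree_sum_monom_q_power_less:
  assumes "q \<ge> 2"
  shows "degree (\<Sum>j<n. monom (c j) (q ^ j) :: 'a::field poly) < q ^ n"
proof (rule degree_sum_less)
  fix j assume "j \<in> {..<n}"
  hence "q ^ j < q ^ n"
    using assms by simp
  thus "degree (monom (c j) (q ^ j) :: 'a poly) < q ^ n"
    using degree_monom_le le_less_trans by blast
qed (use assms in simp)

text \<open>A kernel vector of the transposed Moore matrix is the coefficient vector of a linearized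
  polynomial of degree \<open>< q\<^sup>n\<close> vanishing on the \<open>q\<^sup>n\<close> elements of the span of the \<open>g\<^sub>i\<close>.\<close>

lemma det_moore_nonzero:
  assumes qc: "char_power q TYPE('a::{field,finite})" and cq: "card (Fq q :: 'a set) = q"
    and ind: "Fq_indep q {..<n} (g :: nat \<Rightarrow> 'a)"
  shows "det (moore q n g) \<noteq> 0"
proof
  assume d0: "det (moore q n g) = 0"
  have q2: "q \<ge> 2"
    using char_power_ge_2[OF qc] .
  let ?M = "moore q n g"
  have Mt: "transpose_mat ?M \<in> carrier_mat n n"
    using moore_carrier by simp
  have "det (transpose_mat ?M) = 0"
    using d0 det_transpose[OF moore_carrier[of q n g]] by simp
  then obtain v where v: "v \<in> carrier_vec n" "v \<noteq> 0\<^sub>v n" "transpose_mat ?M *\<^sub>v v = 0\<^sub>v n"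
    using det_0_iff_vec_prod_zero_field[OF Mt] by auto
  define L :: "'a poly" where "L = (\<Sum>j<n. monom (v $ j) (q ^ j))"
  have linL: "linearized q L"
    unfolding L_def by (rule linearized_sum_monom[OF _ q2]) simp
  have "poly L (g l) = 0" if l: "l < n" for l
  proof -
    have "(transpose_mat ?M *\<^sub>v v) $ l = 0"
      using v(3) l by simp
    hence "(\<Sum>j\<in>{0..<n}. g l ^ (q ^ j) * v $ j) = 0"
      using l v(1) by (simp add: scalar_prod_def moore_def)
    thus ?thesis
      unfolding L_def by (simp add: poly_sum poly_monom atLeast0LessThan mult.commute)
  qed
  hence "\<forall>u\<in>Fq_span q n g. poly L u = 0"
    unfolding Fq_span_eq using linearized_vanishes_on_span[OF qc linL, of "{..<n}" g] by auto
  moreover have "degree L < card (Fq_span q n g)"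
    unfolding L_def card_Fq_span[OF qc cq ind] by (rule degree_sum_monom_q_power_less[OF q2])
  ultimately have L0: "L = 0"
    by (meson card_le_degree_if_roots leD)
  have "v $ j = 0" if j: "j < n" for j
  proof -
    have "coeff L (q ^ j) = v $ j"
      unfolding L_def using coeff_sum_monom_q_power[of "{..<n}" q "\<lambda>j. v $ j" "q ^ j"] q2 j by simp
    thus ?thesis
      using L0 by simp
  qed
  hence "v = 0\<^sub>v n"
    using v(1) by (intro eq_vecI) auto
  thus False
    using v(2) by simp
qed

lemma Dmat_carrier: "Dmat q n g i \<in> carrier_mat n n"
  unfolding Dmat_def by simp

text \<open>Only the last column of \<open>\<DD>\<^sub>i\<close> contains non-constant entries, so Laplace expansion along it
  writes the determinant as a combination of the \<open>x\<^sup>[\<^sup>j\<^sup>]\<close> with constant cofactors.\<close>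

lemma linearized_det_Dmat:
  assumes q2: "q \<ge> 2" and n: "n \<ge> 1"
  shows "linearized q (det (Dmat q n g i) :: 'a::field poly)"
proof -
  let ?D = "Dmat q n g i"
  have nn: "n - 1 < n"
    using n by simp
  have lap: "det ?D = (\<Sum>j<n. ?D $$ (j, n - 1) * cofactor ?D j (n - 1))"
    by (rule laplace_expansion_column[OF Dmat_carrier nn])
  have cof: "degree (cofactor ?D j (n - 1)) = 0" for j
  proof -
    have md: "mat_delete ?D j (n - 1) \<in> carrier_mat (n - 1) (n - 1)"
      using mat_delete_carrier[OF Dmat_carrier] by simp
    have "degree (det (mat_delete ?D j (n - 1))) \<le> 0 * (n - 1)"
    proof (rule degree_det_le[OF _ md])
      fix a b assume "a < n - 1" "b < n - 1"
      thus "degree (mat_delete ?D j (n - 1) $$ (a, b)) \<le> 0"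
        unfolding mat_delete_def Dmat_def by auto
    qed
    moreover have "degree ((- 1 :: 'a poly) ^ (j + (n - 1))) \<le> degree (- 1 :: 'a poly) * (j + (n - 1))"
      by (rule degree_power_le)
    ultimately have "degree ((- 1 :: 'a poly) ^ (j + (n - 1))) + degree (det (mat_delete ?D j (n - 1))) = 0"
      by simp
    thus ?thesis
      unfolding cofactor_def using degree_mult_le le_zero_eq by metis
  qed
  have "linearized q (?D $$ (j, n - 1) * cofactor ?D j (n - 1))" if j: "j < n" for j
  proof -
    obtain c where c: "cofactor ?D j (n - 1) = [:c:]"
      using cof[of j] degree_eq_zeroE by blast
    have "?D $$ (j, n - 1) = monom 1 (q ^ j)"
      using j nn unfolding Dmat_def by simp
    hence "?D $$ (j, n - 1) * cofactor ?D j (n - 1) = monom c (q ^ j)"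
      using c by (simp add: mult.commute smult_monom)
    thus ?thesis
      by (simp add: linearized_monom)
  qed
  thus ?thesis
    unfolding lap by (intro linearized_sum) auto
qed

lemma linearized_Lambda_poly:
  assumes "q \<ge> 2" "n \<ge> 1"
  shows "linearized q (Lambda_poly q n g r :: 'a::field poly)"
  unfolding Lambda_poly_def by (intro linearized_smult linearized_sum linearized_det_Dmat[OF assms]) auto

text \<open>Evaluating \<open>\<DD>\<^sub>i\<close> at \<open>g\<^sub>l\<close> gives a matrix \<open>E\<^sub>i\<close> with two equal columns unless \<open>i = l\<close>, and \<open>E\<^sub>l\<close> is
  the Moore matrix with its column \<open>l\<close> moved to the end.\<close>

lemma poly_Lambda_poly:
  fixes g r :: "nat \<Rightarrow> 'a::field"
  assumes dM: "det (moore q n g) \<noteq> 0" and l: "l < n"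
  shows "poly (Lambda_poly q n g r) (g l) = r l"
proof -
  interpret eval: comm_ring_hom "\<lambda>p. poly p (g l)"
    by unfold_locales auto
  define E where "E i = mat n n (\<lambda>(j, c). if c = n - 1 then g l ^ (q ^ j)
      else if c < i then g c ^ (q ^ j) else g (c + 1) ^ (q ^ j))" for i
  have evE: "poly (det (Dmat q n g i)) (g l) = det (E i)" for i
  proof -
    have "map_mat (\<lambda>p. poly p (g l)) (Dmat q n g i) = E i"
      unfolding E_def Dmat_def by (intro eq_matI) (auto simp: poly_monom)
    thus ?thesis
      using eval.hom_det[of "Dmat q n g i"] by simp
  qed
  have E0: "det (E i) = 0" if i: "i < n" "i \<noteq> l" for i
  proof -
    define c0 where "c0 = (if l < i then l else l - 1)"
    have c0: "c0 < n - 1"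
      using i l unfolding c0_def by auto
    have "col (E i) c0 = col (E i) (n - 1)"
    proof (rule eq_vecI)
      fix j assume "j < dim_vec (col (E i) (n - 1))"
      thus "col (E i) c0 $ j = col (E i) (n - 1) $ j"
        using c0 l i unfolding E_def c0_def by auto
    qed (simp add: E_def)
    thus ?thesis
      using det_identical_columns[of "E i" n c0 "n - 1"] c0 l unfolding E_def by auto
  qed
  define s :: 'a where "s = (-1) ^ (n - 1 - l)"
  have ss: "s * s = 1"
    unfolding s_def by (simp flip: power_add)
  have El: "det (moore q n g) = s * det (E l)"
  proof -
    have m: "n = l + 1 + (n - 1 - l)"
      using l by simp
    have "det (moore q n g) = (-1) ^ (1 * (n - 1 - l)) * det (mat n n (\<lambda>(i, j). moore q n g $$ (i,
        if j < l then j else if j < l + (n - 1 - l) then j + 1 else j - (n - 1 - l))))"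
      by (rule det_swap_final_cols[OF moore_carrier m])
    also have "mat n n (\<lambda>(i, j). moore q n g $$ (i,
        if j < l then j else if j < l + (n - 1 - l) then j + 1 else j - (n - 1 - l))) = E l"
      unfolding E_def moore_def using l by (intro eq_matI) auto
    finally show ?thesis
      unfolding s_def by simp
  qed
  have "(\<Sum>i<n. ((-1) ^ (n - 1 - i) * r i) * det (E i)) =
      (\<Sum>i<n. if i = l then ((-1) ^ (n - 1 - i) * r i) * det (E i) else 0)"
    by (intro sum.cong) (auto simp: E0)
  also have "\<dots> = (s * r l) * det (E l)"
    using l unfolding s_def by simp
  also have "det (E l) = s * det (moore q n g)"
    using El ss by (metis mult.assoc mult_1)
  finally have "(\<Sum>i<n. ((-1) ^ (n - 1 - i) * r i) * det (E i)) = r l * det (moore q n g)"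
    using ss by (simp add: ac_simps)
  thus ?thesis
    unfolding Lambda_poly_def using dM by (simp add: poly_sum evE)
qed

section \<open>The interpolation module\<close>

lemma pcompose_x: "pcompose [:0, 1:] (p :: 'a::comm_ring_1 poly) = p"
  by (simp add: pcompose_pCons)

lemma interp_module_eq:
  assumes qc: "char_power q TYPE('a::field)"
  shows "interp_module q n g r = {(pcompose \<beta> (Pi_poly q n g) - pcompose \<gamma> (Lambda_poly q n g r), \<gamma>)
    | \<beta> \<gamma>. linearized q \<beta> \<and> linearized q (\<gamma> :: 'a poly)}"
proof -
  have "vadd (lcomp \<beta> (Pi_poly q n g, 0)) (lcomp \<gamma> (- Lambda_poly q n g r, [:0, 1:]))
      = (pcompose \<beta> (Pi_poly q n g) - pcompose \<gamma> (Lambda_poly q n g r), \<gamma>)"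
    if "linearized q \<beta>" "linearized q \<gamma>" for \<beta> \<gamma>
    unfolding vadd_def lcomp_def
    using pcompose_linearized_uminus[OF qc that(2)] pcompose_linearized_0[OF _ that(1)] char_power_ge_2[OF qc]
    by simp
  thus ?thesis
    unfolding interp_module_def by (intro Collect_cong) metis
qed

lemma is_basis2_mem_nonzero:
  assumes "is_basis2 q M b1 b2"
  shows "b1 \<in> M" "b2 \<in> M" "b1 \<noteq> (0, 0)" "b2 \<noteq> (0, 0)"
proof -
  have e1: "vadd (lcomp [:0, 1:] b1) (lcomp 0 b2) = b1"
    and e2: "vadd (lcomp 0 b1) (lcomp [:0, 1:] b2) = b2"
    unfolding vadd_def lcomp_def by (simp_all add: pcompose_x)
  have M: "M = {vadd (lcomp a1 b1) (lcomp a2 b2) | a1 a2. linearized q a1 \<and> linearized q a2}"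
    using assms unfolding is_basis2_def by simp
  have ind: "linearized q a1 \<Longrightarrow> linearized q a2 \<Longrightarrow> vadd (lcomp a1 b1) (lcomp a2 b2) = (0, 0)
      \<Longrightarrow> a1 = 0 \<and> a2 = 0" for a1 a2
    using assms unfolding is_basis2_def by simp
  show "b1 \<in> M"
    unfolding M by (rule CollectI, rule exI[of _ "[:0, 1:]"], rule exI[of _ 0]) (simp add: e1 linearized_x)
  show "b2 \<in> M"
    unfolding M by (rule CollectI, rule exI[of _ 0], rule exI[of _ "[:0, 1:]"]) (simp add: e2 linearized_x)
  show "b1 \<noteq> (0, 0)"
    using ind[OF linearized_x linearized_0] e1 by auto
  show "b2 \<noteq> (0, 0)"
    using ind[OF linearized_0 linearized_x] e2 by auto
qed

section \<open>The degree bound behind unique decoding\<close>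

text \<open>If \<open>h(g\<^sub>i) = y(e\<^sub>i)\<close> for all \<open>i\<close>, then \<open>h\<close> vanishes on the kernel of the \<open>\<bbbF>\<^sub>q\<close>-linear map
  \<open>g\<^sub>i \<mapsto> e\<^sub>i\<close>, a subspace of dimension \<open>n - rank e\<close>; it is spanned by the vectors obtained from
  \<open>g\<^sub>j\<close>, \<open>j \<notin> S\<close>, by subtracting the combination of \<open>g\<^sub>S\<close> that expresses \<open>e\<^sub>j\<close> through \<open>e\<^sub>S\<close>.\<close>

lemma q_power_corank_le_degree:
  assumes qc: "char_power q TYPE('a::{field,finite})" and cq: "card (Fq q :: 'a set) = q"
    and ind: "Fq_indep q {..<n} g" and S: "S \<subseteq> {..<n}"
    and span: "\<And>i. i < n \<Longrightarrow> e i \<in> Fq_span_on q S e"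
    and h: "linearized q h" "h \<noteq> 0" and y: "linearized q y"
    and hy: "\<And>i. i < n \<Longrightarrow> poly h (g i) = poly y (e i :: 'a)"
  shows "q ^ (n - card S) \<le> degree h"
proof -
  have finS: "finite S"
    using S finite_subset by blast
  have "\<forall>j\<in>{..<n}. \<exists>c. (\<forall>l\<in>S. c l \<in> Fq q) \<and> e j = (\<Sum>l\<in>S. c l * e l)"
    using span unfolding Fq_span_on_def by blast
  then obtain a where a: "\<And>j. j < n \<Longrightarrow> (\<forall>l\<in>S. a j l \<in> Fq q) \<and> e j = (\<Sum>l\<in>S. a j l * e l)"
    by (metis lessThan_iff)
  define J where "J = {..<n} - S"
  define g' where "g' j = g j - (\<Sum>l\<in>S. a j l * g l)" for j
  have "Fq_indep q J g'"
    unfolding J_def g'_def by (rule Fq_indep_eliminate[OF qc ind S]) (use a in auto)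
  hence "card (Fq_span_on q J g') = q ^ (n - card S)"
    using card_Fq_span_on[OF qc] cq card_Diff_subset[OF finS S] unfolding J_def by simp
  moreover have "poly h (g' j) = 0" if "j \<in> J" for j
  proof -
    have j: "j < n" "\<forall>l\<in>S. a j l \<in> Fq q"
      using that a unfolding J_def by auto
    have "poly h (g' j) = poly y (e j) - (\<Sum>l\<in>S. a j l * poly y (e l))"
      unfolding g'_def using j S hy
      by (simp add: poly_linearized_diff[OF qc h(1)] poly_linearized_Fq_comb[OF qc h(1) finS] subset_iff)
    also have "\<dots> = 0"
      using a[OF j(1)] poly_linearized_Fq_comb[OF qc y finS, of "a j" e] by simp
    finally show ?thesis .
  qed
  hence "\<forall>u\<in>Fq_span_on q J g'. poly h u = 0"
    using linearized_vanishes_on_span[OF qc h(1)] unfolding J_def by blast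
  ultimately show ?thesis
    using card_le_degree_if_roots[OF h(2)] by metis
qed

text \<open>A codeword \<open>f\<close> at rank distance \<open>t \<le> (n - k) / 2\<close> from \<open>r\<close>, witnessed by an independent
  subfamily \<open>e\<^sub>S\<close> spanning all errors, and a basis of the interpolation module with leading positions
  1 and 2.\<close>

locale gabidulin_decoding =
  fixes q n k t :: nat and g r e :: "nat \<Rightarrow> 'a::{field,finite}" and f :: "'a poly"
    and S :: "nat set" and v1 v2 u1 u2 :: "'a poly"
  assumes char_q: "char_power q TYPE('a)" and card_Fq_q: "card (Fq q :: 'a set) = q"
    and k_pos: "1 \<le> k" and k_le_n: "k \<le> n"
    and g_indep: "Fq_indep q {..<n} g"
    and f_linearized: "linearized q f" and f_degree: "degree f < q ^ k"
    and error_eq: "\<And>i. i < n \<Longrightarrow> e i = poly f (g i) - r i"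
    and S_subset: "S \<subseteq> {..<n}" and card_S: "card S = t" and S_indep: "Fq_indep q S e"
    and S_spans: "\<And>i. i < n \<Longrightarrow> e i \<in> Fq_span_on q S e"
    and radius: "2 * t \<le> n - k"
    and basis: "is_basis2 q (interp_module q n g r) (v1, v2) (u1, u2)"
    and lpos_v: "lpos q k (v1, v2) = 1" and lpos_u: "lpos q k (u1, u2) = 2"
begin

abbreviation M :: "('a poly \<times> 'a poly) set" where
  "M \<equiv> interp_module q n g r"

abbreviation K :: nat where
  "K \<equiv> q ^ (k - 1)"

lemma q_ge_2: "q \<ge> 2"
  using char_power_ge_2[OF char_q] .

lemma t_bound: "t + k - 1 < n - t"
  using radius k_pos k_le_n by linarith

lemma M_eq: "M = {(pcompose \<beta> (Pi_poly q n g) - pcompose \<gamma> (Lambda_poly q n g r), \<gamma>)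
    | \<beta> \<gamma>. linearized q \<beta> \<and> linearized q \<gamma>}"
  by (rule interp_module_eq[OF char_q])

lemma Lambda_linearized: "linearized q (Lambda_poly q n g r)"
  by (rule linearized_Lambda_poly[OF q_ge_2]) (use k_pos k_le_n in simp)

lemma Pi_vanishes_on_g: "i < n \<Longrightarrow> poly (Pi_poly q n g) (g i) = 0"
  using poly_Pi_poly_span[OF char_q card_Fq_q g_indep] Fq_span_on_generator[of q "{..<n}" i g] q_ge_2
  unfolding Fq_span_eq by simp

lemma Lambda_interpolates: "i < n \<Longrightarrow> poly (Lambda_poly q n g r) (g i) = r i"
  using poly_Lambda_poly[OF det_moore_nonzero[OF char_q card_Fq_q g_indep]] .

lemma M_linearized:
  assumes "v \<in> M"
  shows "linearized q (fst v)" "linearized q (snd v)"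
  using assms char_q
  by (auto simp: M_eq intro!: linearized_diff linearized_pcompose linearized_Pi_poly[OF char_q card_Fq_q g_indep]
      Lambda_linearized)

text \<open>Composing with the codeword \<open>f\<close> turns the interpolation condition \<open>v\<^sub>1(g\<^sub>i) + v\<^sub>2(r\<^sub>i) = 0\<close>
  into a condition involving only the errors.\<close>

lemma M_errors:
  assumes "v \<in> M" "i < n"
  shows "poly (fst v + pcompose (snd v) f) (g i) = poly (snd v) (e i)"
proof -
  obtain \<beta> \<gamma> where lin: "linearized q \<beta>" "linearized q \<gamma>"
    and v: "v = (pcompose \<beta> (Pi_poly q n g) - pcompose \<gamma> (Lambda_poly q n g r), \<gamma>)"
    using assms(1) unfolding M_eq by blast
  have "poly \<gamma> (poly f (g i)) = poly \<gamma> (e i) + poly \<gamma> (r i)"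
    using error_eq[OF assms(2)] poly_linearized_add[OF char_q lin(2)] by (metis diff_add_cancel)
  thus ?thesis
    unfolding v using Lambda_interpolates[OF assms(2)] Pi_vanishes_on_g[OF assms(2)]
      linearized_poly_0[OF _ lin(1)] q_ge_2
    by (simp add: poly_pcompose)
qed

lemma basis_in_M: "(v1, v2) \<in> M" "(u1, u2) \<in> M"
  using is_basis2_mem_nonzero[OF basis] by simp_all

lemma basis_linearized: "linearized q v1" "linearized q v2" "linearized q u1" "linearized q u2"
  using M_linearized[OF basis_in_M(1)] M_linearized[OF basis_in_M(2)] by simp_all

lemma M_decomp:
  assumes "w \<in> M"
  obtains a1 a2 where "linearized q a1" "linearized q a2" "w = vadd (lcomp a1 (v1, v2)) (lcomp a2 (u1, u2))"
  using assms basis unfolding is_basis2_def by blast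

lemma v_leads: "leads_in_first K (v1, v2)"
  using leads_in_first_if_lpos_1[OF q_ge_2 basis_linearized(1,2)] is_basis2_mem_nonzero(3)[OF basis] lpos_v .

lemma u_leads: "leads_in_second K (u1, u2)"
  using leads_in_second_if_lpos_2[OF q_ge_2 basis_linearized(3,4)] is_basis2_mem_nonzero(4)[OF basis] lpos_u .

lemma predictable_degree_basis:
  assumes "linearized q a1" "linearized q a2"
  obtains "a1 = 0" "a2 = 0"
  | "a2 \<noteq> 0" "leads_in_second K (vadd (lcomp a1 (v1, v2)) (lcomp a2 (u1, u2)))"
      "degree (pcompose a1 v2 + pcompose a2 u2) = degree a2 * degree u2"
  | "a1 \<noteq> 0" "leads_in_first K (vadd (lcomp a1 (v1, v2)) (lcomp a2 (u1, u2)))"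
      "degree (pcompose a1 v1 + pcompose a2 u1) = degree a1 * degree v1"
  using predictable_degree[OF q_ge_2 assms basis_linearized(1,4) v_leads u_leads] by blast

lemma degree_pcompose_f_le: "degree (pcompose p f) \<le> degree p * K"
  using degree_linearized_le_q_power[OF q_ge_2 f_linearized f_degree] by (simp add: degree_pcompose)

lemma card_error_span: "card (Fq_span_on q S e) = q ^ t"
  using card_Fq_span_on[OF char_q _ S_indep] card_Fq_q card_S S_subset finite_subset by fastforce

lemma degree_ge_if_kills_errors:
  assumes "linearized q y" "y \<noteq> 0" "\<And>i. i < n \<Longrightarrow> poly y (e i) = 0"
  shows "q ^ t \<le> degree y"
proof -
  have "\<forall>u\<in>Fq_span_on q S e. poly y u = 0"
    using linearized_vanishes_on_span[OF char_q assms(1), of S e] assms(3) S_subset finite_subset by blast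
  thus ?thesis
    using card_le_degree_if_roots[OF assms(2)] card_error_span by metis
qed

text \<open>The error locator \<open>W\<close> (the monic annihilator of the errors) yields the module element
  \<open>(- W \<circ> f, W)\<close>, because \<open>W \<circ> (\<Lambda> - f)\<close> kills every \<open>g\<^sub>i\<close> and is therefore a right multiple of \<open>\<Pi>\<^sub>g\<close>.\<close>

lemma error_locator:
  obtains W where "linearized q W" "W \<noteq> 0" "degree W = q ^ t" "(- pcompose W f, W) \<in> M"
proof -
  obtain W where W: "linearized q W" "lead_coeff W = 1" "degree W = q ^ t" "\<forall>i\<in>S. poly W (e i) = 0"
    using monic_annihilator_exists[OF char_q, of S e] S_subset finite_subset card_S by blast
  have We: "poly W (e i) = 0" if "i < n" for i
    using linearized_vanishes_on_span[OF char_q W(1) _ _ S_spans[OF that]] W(4) S_subset finite_subset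
    by blast
  define A where "A = pcompose W (Lambda_poly q n g r - f)"
  have linA: "linearized q A"
    unfolding A_def by (intro linearized_pcompose[OF char_q W(1)] linearized_diff Lambda_linearized f_linearized)
  have "poly A (g i) = 0" if "i < n" for i
  proof -
    have "poly A (g i) = poly W (- e i)"
      unfolding A_def using that Lambda_interpolates error_eq by (simp add: poly_pcompose)
    thus ?thesis
      using We[OF that] poly_linearized_uminus[OF char_q W(1)] by simp
  qed
  hence "\<forall>u\<in>Fq_span q n g. poly A u = 0"
    unfolding Fq_span_eq using linearized_vanishes_on_span[OF char_q linA, of "{..<n}" g] by auto
  then obtain \<beta> where \<beta>: "linearized q \<beta>" "A = pcompose \<beta> (Pi_poly q n g)"
    using linearized_right_factor[OF char_q linearized_Pi_poly lead_coeff_Pi_poly degree_Pi_poly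
        _ card_Fq_span linA] char_q card_Fq_q g_indep poly_Pi_poly_span by metis
  have "pcompose \<beta> (Pi_poly q n g) = pcompose W (Lambda_poly q n g r) - pcompose W f"
    using \<beta>(2) unfolding A_def by (simp add: pcompose_linearized_diff[OF char_q W(1)])
  hence "pcompose \<beta> (Pi_poly q n g) - pcompose W (Lambda_poly q n g r) = - pcompose W f"
    by simp
  hence "(- pcompose W f, W) \<in> M"
    unfolding M_eq using \<beta>(1) W(1) by force
  moreover have "W \<noteq> 0"
    using W(2) by auto
  ultimately show thesis
    using that W(1,3) by blast
qed

lemma degree_u2_le: "degree u2 \<le> q ^ t"
proof -
  obtain W where W: "linearized q W" "W \<noteq> 0" "degree W = q ^ t" "(- pcompose W f, W) \<in> M"
    by (rule error_locator)
  obtain a1 a2 where a: "linearized q a1" "linearized q a2"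
    and eq: "(- pcompose W f, W) = vadd (lcomp a1 (v1, v2)) (lcomp a2 (u1, u2))"
    using M_decomp[OF W(4)] by blast
  have z: "pcompose a1 v1 + pcompose a2 u1 = - pcompose W f" "pcompose a1 v2 + pcompose a2 u2 = W"
    using eq unfolding vadd_def lcomp_def by (metis fst_conv snd_conv)+
  show ?thesis
  proof (cases rule: predictable_degree_basis[OF a])
    case 1
    thus ?thesis
      using z W(2) by simp
  next
    case 2
    have "degree a2 \<ge> 1"
      using degree_linearized_pos[OF q_ge_2 a(2) 2(1)] .
    thus ?thesis
      using 2(3) z W(3) by (metis mult_le_mono1 mult_1)
  next
    case 3
    txt \<open>The first position would have to lead although \<open>W \<circ> f\<close> has weighted degree at most that of \<open>W\<close>.\<close>
    hence "degree W * K < degree (pcompose W f)"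
      using z W(2) unfolding leads_in_first_def vadd_def lcomp_def by simp
    thus ?thesis
      using degree_pcompose_f_le[of W] by simp
  qed
qed

lemma u2_kills_errors: "i < n \<Longrightarrow> poly u2 (e i) = 0"
proof -
  define h where "h = u1 + pcompose u2 f"
  have "degree h \<le> degree u2 * K"
    unfolding h_def using u_leads degree_pcompose_f_le[of u2]
    by (intro degree_add_le) (simp_all add: leads_in_second_def)
  also have "\<dots> \<le> q ^ t * q ^ (k - 1)"
    using degree_u2_le by simp
  also have "\<dots> < q ^ (n - t)"
    using t_bound k_pos q_ge_2 by (simp flip: power_add)
  finally have "h = 0"
    using q_power_corank_le_degree[OF char_q card_Fq_q g_indep S_subset S_spans _ _ basis_linearized(4),
        of h] M_errors[OF basis_in_M(2)] basis_linearized(3,4) linearized_add linearized_pcompose[OF char_q]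
      f_linearized card_S unfolding h_def by fastforce
  thus "i < n \<Longrightarrow> poly u2 (e i) = 0"
    using M_errors[OF basis_in_M(2)] unfolding h_def by simp
qed

lemma degree_u2: "degree u2 = q ^ t"
  using degree_ge_if_kills_errors[OF basis_linearized(4) _ u2_kills_errors] u_leads degree_u2_le
  unfolding leads_in_second_def by fastforce

lemma degree_v1_ge: "q ^ (n - t) \<le> degree v1"
proof -
  define h where "h = v1 + pcompose v2 f"
  have v1: "v1 \<noteq> 0"
    using v_leads unfolding leads_in_first_def by simp
  have "degree (pcompose v2 f) < degree v1"
  proof (cases "v2 = 0")
    case True
    thus ?thesis
      using v1 degree_linearized_pos[OF q_ge_2 basis_linearized(1) v1] q_ge_2
        pcompose_linearized_0[OF _ basis_linearized(2)] by simp
  next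
    case False
    thus ?thesis
      using v_leads degree_pcompose_f_le[of v2] unfolding leads_in_first_def by simp
  qed
  hence "degree h = degree v1"
    unfolding h_def by (rule degree_add_eq_left)
  moreover have "h \<noteq> 0"
    using calculation degree_linearized_pos[OF q_ge_2 basis_linearized(1) v1] by auto
  ultimately show ?thesis
    using q_power_corank_le_degree[OF char_q card_Fq_q g_indep S_subset S_spans _ _ basis_linearized(2),
        of h] M_errors[OF basis_in_M(1)] basis_linearized(1,2) linearized_add linearized_pcompose[OF char_q]
      f_linearized card_S unfolding h_def by fastforce
qed

lemma u2_vanishes_on_error_span: "y \<in> Fq_span_on q S e \<Longrightarrow> poly u2 y = 0"
  using linearized_vanishes_on_span[OF char_q basis_linearized(4), of S e] u2_kills_errors S_subset
    finite_subset by blast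

text \<open>In the decomposition of \<open>(- \<Lambda>, x)\<close> the second component gives \<open>d\<^sub>1 \<circ> v\<^sub>2 + d\<^sub>2 \<circ> u\<^sub>2 = x\<close>, so \<open>d\<^sub>1\<close>
  inverts \<open>v\<^sub>2\<close> where \<open>u\<^sub>2\<close> vanishes.\<close>

lemma v2_inj_on_error_span: "inj_on (poly v2) (Fq_span_on q S e)"
proof -
  have "(- Lambda_poly q n g r, [:0, 1:]) \<in> M"
    unfolding M_eq by (rule CollectI, rule exI[of _ 0], rule exI[of _ "[:0, 1:]"]) (simp add: pcompose_x linearized_x)
  then obtain d1 d2 where d: "linearized q d1" "linearized q d2"
    and eq: "(- Lambda_poly q n g r, [:0, 1:]) = vadd (lcomp d1 (v1, v2)) (lcomp d2 (u1, u2))"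
    by (rule M_decomp)
  have x_eq: "pcompose d1 v2 + pcompose d2 u2 = [:0, 1:]"
    using eq unfolding vadd_def lcomp_def by (metis snd_conv)
  have "poly d1 (poly v2 y) = y" if "y \<in> Fq_span_on q S e" for y
  proof -
    have "y = poly (pcompose d1 v2 + pcompose d2 u2) y"
      unfolding x_eq by simp
    thus ?thesis
      using u2_vanishes_on_error_span[OF that] linearized_poly_0[OF _ d(2)] q_ge_2 by (simp add: poly_pcompose)
  qed
  thus ?thesis
    by (rule inj_on_inverseI)
qed

lemma Pi_decomp:
  obtains a1 a2 where "linearized q a1" "linearized q a2" "a1 \<noteq> 0" "q ^ n = degree a1 * degree v1"
    "pcompose a1 v2 + pcompose a2 u2 = 0"
proof -
  have "(Pi_poly q n g, 0) \<in> M"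
    unfolding M_eq by (rule CollectI, rule exI[of _ "[:0, 1:]"], rule exI[of _ 0]) (simp add: pcompose_x linearized_x)
  then obtain a1 a2 where a: "linearized q a1" "linearized q a2"
    and eq: "(Pi_poly q n g, 0) = vadd (lcomp a1 (v1, v2)) (lcomp a2 (u1, u2))"
    by (rule M_decomp)
  have Pi0: "Pi_poly q n g \<noteq> 0"
    using lead_coeff_Pi_poly[OF char_q card_Fq_q g_indep] by auto
  have "a1 \<noteq> 0 \<and> degree (Pi_poly q n g) = degree a1 * degree v1"
  proof (cases rule: predictable_degree_basis[OF a])
    case 1
    thus ?thesis
      using eq Pi0 unfolding vadd_def lcomp_def by simp
  next
    case 2
    thus ?thesis
      using eq unfolding leads_in_second_def vadd_def lcomp_def by simp
  next
    case 3
    thus ?thesis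
      using eq unfolding vadd_def lcomp_def by simp
  qed
  moreover have "pcompose a1 v2 + pcompose a2 u2 = 0"
    using eq unfolding vadd_def lcomp_def by simp
  ultimately show thesis
    using that a degree_Pi_poly[OF char_q card_Fq_q g_indep] by simp
qed

text \<open>In \<open>(\<Pi>\<^sub>g, 0) = a\<^sub>1 \<circ> (v\<^sub>1, v\<^sub>2) + a\<^sub>2 \<circ> (u\<^sub>1, u\<^sub>2)\<close> the factor \<open>a\<^sub>1\<close> vanishes on the \<open>q^t\<close> values of \<open>v\<^sub>2\<close>
  on the error span.\<close>

lemma degree_v1_le: "degree v1 \<le> q ^ (n - t)"
proof -
  obtain a1 a2 where a: "linearized q a1" "linearized q a2" "a1 \<noteq> 0" "q ^ n = degree a1 * degree v1"
    and zero: "pcompose a1 v2 + pcompose a2 u2 = 0"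
    by (rule Pi_decomp)
  have "poly a1 (poly v2 y) = 0" if "y \<in> Fq_span_on q S e" for y
  proof -
    have "0 = poly (pcompose a1 v2 + pcompose a2 u2) y"
      using zero by simp
    thus ?thesis
      using u2_vanishes_on_error_span[OF that] linearized_poly_0[OF _ a(2)] q_ge_2 by (simp add: poly_pcompose)
  qed
  hence "card (poly v2 ` Fq_span_on q S e) \<le> degree a1"
    using card_le_degree_if_roots[OF a(3)] by blast
  hence "q ^ t \<le> degree a1"
    using card_image[OF v2_inj_on_error_span] card_error_span by simp
  hence "q ^ t * degree v1 \<le> q ^ t * q ^ (n - t)"
    using a(4) t_bound by (simp flip: power_add)
  thus ?thesis
    using q_ge_2 by simp
qed

theorem weighted_degrees:
  shows "wqdeg q k (u1, u2) = t + k - 1" "qdeg q u2 = t" "wqdeg q k (v1, v2) = n - t"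
proof -
  have qu2: "qdeg q u2 = t"
    using qdeg_eqI[OF q_ge_2 degree_u2] .
  have qv1: "qdeg q v1 = n - t"
    using qdeg_eqI[OF q_ge_2] degree_v1_le degree_v1_ge by simp
  note lp1 = lpos_1_D[OF q_ge_2 basis_linearized(1,2) is_basis2_mem_nonzero(3)[OF basis] lpos_v]
  note lp2 = lpos_2_D[OF q_ge_2 basis_linearized(3,4) is_basis2_mem_nonzero(4)[OF basis] lpos_u]
  show "wqdeg q k (u1, u2) = t + k - 1"
    using wqdeg_second[OF lp2] qu2 k_pos by simp
  show "qdeg q u2 = t"
    by (fact qu2)
  show "wqdeg q k (v1, v2) = n - t"
    using wqdeg_first[OF lp1] qv1 by simp
qed

end

section \<open>Rank distance and the main result\<close>

lemma rank_values:
  "finite {card S | S. S \<subseteq> {..<n} \<and> Fq_indep q S v}"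
  "0 \<in> {card S | S. S \<subseteq> {..<n} \<and> Fq_indep q S v}"
proof -
  have "{card S | S. S \<subseteq> {..<n} \<and> Fq_indep q S v} \<subseteq> card ` Pow {..<n}"
    by auto
  thus "finite {card S | S. S \<subseteq> {..<n} \<and> Fq_indep q S v}"
    by (rule finite_subset) simp
  have "Fq_indep q {} v"
    unfolding Fq_indep_def by simp
  thus "0 \<in> {card S | S. S \<subseteq> {..<n} \<and> Fq_indep q S v}"
    by force
qed

lemma rank_dist_le: "rank_dist q n a b \<le> n"
  unfolding rank_dist_def
proof (rule Max.boundedI[OF rank_values(1)])
  show "{card S | S. S \<subseteq> {..<n} \<and> Fq_indep q S (\<lambda>i. a i - b i)} \<noteq> {}"
    using rank_values(2) by blast
  fix x assume "x \<in> {card S | S. S \<subseteq> {..<n} \<and> Fq_indep q S (\<lambda>i. a i - b i)}"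
  then obtain S where "S \<subseteq> {..<n}" "x = card S"
    by blast
  thus "x \<le> n"
    using card_mono[of "{..<n}" S] by simp
qed

lemma Fq_span_on_if_insert_dependent:
  assumes qc: "char_power q TYPE('a::field)" and finS: "finite S" and "j \<notin> S"
    and ind: "Fq_indep q S w" and dep: "\<not> Fq_indep q (insert j S) (w :: nat \<Rightarrow> 'a)"
  shows "w j \<in> Fq_span_on q S w"
proof -
  obtain c where "\<not> ((\<forall>i\<in>insert j S. c i \<in> Fq q) \<and> (\<Sum>i\<in>insert j S. c i * w i) = 0
      \<longrightarrow> (\<forall>i\<in>insert j S. c i = 0))"
    using dep unfolding Fq_indep_def by blast
  hence c: "\<forall>i\<in>insert j S. c i \<in> Fq q" "(\<Sum>i\<in>insert j S. c i * w i) = 0"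
    "\<exists>i\<in>insert j S. c i \<noteq> 0"
    by blast+
  have sum: "c j * w j = - (\<Sum>i\<in>S. c i * w i)"
    using c(2) finS \<open>j \<notin> S\<close> by (simp add: eq_neg_iff_add_eq_0)
  have cj: "c j \<noteq> 0"
  proof
    assume "c j = 0"
    hence "(\<forall>i\<in>S. c i \<in> Fq q) \<and> (\<Sum>i\<in>S. c i * w i) = 0"
      using sum c(1) by simp
    hence "\<forall>i\<in>S. c i = 0"
      by (rule ind[unfolded Fq_indep_def, THEN spec, THEN mp])
    thus False
      using c(3) \<open>c j = 0\<close> by auto
  qed
  have "w j = (c j * w j) / c j"
    using cj by simp
  also have "\<dots> = - (\<Sum>i\<in>S. c i * w i) / c j"
    unfolding sum ..
  also have "\<dots> = (\<Sum>i\<in>S. (- c i / c j) * w i)"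
    by (simp add: sum_divide_distrib sum_negf[symmetric] divide_inverse sum_distrib_left mult_ac)
  finally have wj: "w j = (\<Sum>i\<in>S. (- c i / c j) * w i)" .
  have coeff_Fq: "\<forall>i\<in>S. - (c i / c j) \<in> Fq q"
    using c(1) by (auto intro!: Fq_uminus[OF qc] Fq_divide)
  show ?thesis
    unfolding Fq_span_on_def by (rule CollectI, rule exI[of _ "\<lambda>i. - c i / c j"]) (simp add: wj coeff_Fq)
qed

text \<open>A maximal independent subfamily spans the whole family.\<close>

lemma rank_dist_basis:
  assumes qc: "char_power q TYPE('a::field)"
  obtains S where "S \<subseteq> {..<n}" "card S = rank_dist q n a b" "Fq_indep q S (\<lambda>i. a i - b i :: 'a)"
    "\<And>j. j < n \<Longrightarrow> a j - b j \<in> Fq_span_on q S (\<lambda>i. a i - b i)"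
proof -
  let ?w = "\<lambda>i. a i - b i"
  let ?R = "{card S | S. S \<subseteq> {..<n} \<and> Fq_indep q S ?w}"
  have "?R \<noteq> {}"
    using rank_values(2) by blast
  hence "rank_dist q n a b \<in> ?R"
    unfolding rank_dist_def by (rule Max_in[OF rank_values(1)])
  then obtain S where S: "rank_dist q n a b = card S" "S \<subseteq> {..<n}" "Fq_indep q S ?w"
    unfolding mem_Collect_eq by (elim exE conjE) (rule that; assumption)
  have finS: "finite S"
    using S(2) finite_subset by blast
  have "?w j \<in> Fq_span_on q S ?w" if j: "j < n" for j
  proof (cases "j \<in> S")
    case True
    show ?thesis
      by (rule Fq_span_on_generator[OF _ finS True]) (use char_power_ge_2[OF qc] in simp)
  next
    case False
    have "card (insert j S) \<notin> ?R"
    proof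
      assume "card (insert j S) \<in> ?R"
      hence "card (insert j S) \<le> rank_dist q n a b"
        unfolding rank_dist_def by (rule Max_ge[OF rank_values(1)])
      thus False
        using S(1) False finS by simp
    qed
    moreover have "card (insert j S) \<in> ?R" if "Fq_indep q (insert j S) ?w"
      unfolding mem_Collect_eq by (rule exI[of _ "insert j S"]) (use that S(2) j in simp)
    ultimately have "\<not> Fq_indep q (insert j S) ?w"
      by blast
    thus ?thesis
      by (rule Fq_span_on_if_insert_dependent[OF qc finS False S(3)])
  qed
  thus thesis
    by (rule that[OF S(2) S(1)[symmetric] S(3)])
qed

lemma closest_codeword:
  assumes "q > 0"
  obtains f where "linearized q f" "degree f < q ^ k"
    "rank_dist q n (\<lambda>i. if i < n then poly f (g i) else 0) r = Min ((\<lambda>c. rank_dist q n c r) ` gabidulin q n k g)"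
proof -
  let ?T = "(\<lambda>c. rank_dist q n c r) ` gabidulin q n k g"
  have "(\<lambda>i. if i < n then poly 0 (g i) else 0) \<in> gabidulin q n k g"
    unfolding gabidulin_def using assms by (intro CollectI exI[of _ 0]) simp
  hence ne: "?T \<noteq> {}"
    by blast
  have "?T \<subseteq> {..n}"
    using rank_dist_le by auto
  hence "finite ?T"
    by (rule finite_subset) simp
  hence "Min ?T \<in> ?T"
    using ne by (rule Min_in)
  then obtain c where c: "c \<in> gabidulin q n k g" "Min ?T = rank_dist q n c r"
    by (rule imageE)
  then obtain f where "linearized q f" "degree f < q ^ k" "c = (\<lambda>i. if i < n then poly f (g i) else 0)"
    unfolding gabidulin_def by blast
  thus thesis
    using that c(2) by simp
qed

theorem lemma33:
  fixes q m n k :: nat and g r :: "nat \<Rightarrow> 'a::{field, finite}"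
    and b1 b2 :: "'a poly \<times> 'a poly"
  assumes "\<exists>p e. prime p \<and> e \<ge> 1 \<and> q = p ^ e"
    and "m \<ge> 1" and "card (UNIV :: 'a set) = q ^ m"
    and "1 \<le> k" and "k \<le> n"
    and "Fq_indep q {..<n} g"
    and "minimal_basis2 q k (interp_module q n g r) b1 b2"
    and "lpos q k b1 = 1" and "lpos q k b2 = 2"
    and "2 * Min ((\<lambda>c. rank_dist q n c r) ` gabidulin q n k g) \<le> n - k"
  shows "wqdeg q k b2 = Min ((\<lambda>c. rank_dist q n c r) ` gabidulin q n k g) + k - 1 \<and>
         qdeg q (snd b2) = Min ((\<lambda>c. rank_dist q n c r) ` gabidulin q n k g) \<and>
         wqdeg q k b1 = n - Min ((\<lambda>c. rank_dist q n c r) ` gabidulin q n k g)"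
proof -
  obtain p e where p: "prime p" "e \<ge> 1" "q = p ^ e"
    using assms(1) by blast
  have qc: "char_power q TYPE('a)"
    using char_power_if_card_prime_power[where 'a='a, OF p(1,2) assms(2)] assms(3) unfolding p(3) by simp
  have cq: "card (Fq q :: 'a set) = q"
    using card_Fq[OF qc assms(2,3)] .
  have "q > 0"
    using char_power_ge_2[OF qc] by simp
  then obtain f where f: "linearized q f" "degree f < q ^ k"
    and t: "rank_dist q n (\<lambda>i. if i < n then poly f (g i) else 0) r
      = Min ((\<lambda>c. rank_dist q n c r) ` gabidulin q n k g)"
    by (rule closest_codeword)
  define e where "e i = (if i < n then poly f (g i) else 0) - r i" for i
  obtain S where S: "S \<subseteq> {..<n}" "card S = Min ((\<lambda>c. rank_dist q n c r) ` gabidulin q n k g)"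
    "Fq_indep q S e" "\<And>j. j < n \<Longrightarrow> e j \<in> Fq_span_on q S e"
    using rank_dist_basis[OF qc, of n "\<lambda>i. if i < n then poly f (g i) else 0" r] unfolding t e_def by blast
  obtain v1 v2 u1 u2 where b: "b1 = (v1, v2)" "b2 = (u1, u2)"
    by fastforce
  interpret gabidulin_decoding q n k "Min ((\<lambda>c. rank_dist q n c r) ` gabidulin q n k g)" g r e f S v1 v2 u1 u2
  proof
    show "is_basis2 q (interp_module q n g r) (v1, v2) (u1, u2)"
      using assms(7) b unfolding minimal_basis2_def by simp
  qed (use qc cq assms(4-6,8-10) f S b e_def in simp_all)
  show ?thesis
    using weighted_degrees b by simp
qed

end
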